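(* Let $\mathfrak{E}$ be the steering ellipsoid of a two-qubit X state, and let $[\rho^{AB}]_{\mathfrak{E}}$ be the set of all X states whose steering ellipsoid is $\mathfrak{E}$. Then $\mathfrak{E}$ is of (at least) one of the following three types. (i) (Type $\mathfrak{E}_{\leftrightarrow}$) For every state in $[\rho^{AB}]_{\mathfrak{E}}$, the horizontal decomposition of $\rho^B$ is optimal. (ii) (Type $\mathfrak{E}_{\updownarrow}$) For every state in $[\rho^{AB}]_{\mathfrak{E}}$, the vertical decomposition of $\rho^B$ is optimal. (iii) (Type $\mathfrak{E}_{\triangle}$) For some states in $[\rho^{AB}]_{\mathfrak{E}}$ the horizontal decomposition of $\rho^B$ is optimal, while for the other states in $[\rho^{AB}]_{\mathfrak{E}}$ a three-state decomposition of $\rho^B$ is optimal. Moreover, the components of the optimal three-state decomposition are identical for all states of the latter kind: there are three fixed points $B_1,B_2,B_3$ of the ellipse $\mathbf{E}$ such that for each such state the optimal three-state decomposition expresses $B$ as a convex combination of $B_1,B_2,B_3$ (only the weights depend on the state).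
   Context: An X state (up to local unitaries) is a two-qubit density matrix, in the product basis $|00\rangle,|01\rangle,|10\rangle,|11\rangle$ (first factor $A$, second factor $B$), $$\rho^{AB}=\begin{pmatrix} a & 0 & 0 & u \\ 0 & b & v & 0 \\ 0 & v & c & 0 \\ u & 0 & 0 & d \end{pmatrix},$$ with $a,b,c,d\ge 0$, $a+b+c+d=1$, $u,v\ge 0$, $u^2\le ad$, $v^2\le bc$; it is assumed that $(a+b)(c+d)>0$. Put $$\ell_1=\tfrac{u+v}{\sqrt{(a+b)(c+d)}},\quad \ell_2=\tfrac{|u-v|}{\sqrt{(a+b)(c+d)}},\quad \ell_3=\tfrac{|ad-bc|}{(a+b)(c+d)},\quad z_0=\tfrac{ac-bd}{(a+b)(c+d)}.$$ The steering ellipsoid $\mathfrak{E}$ is the ellipsoid in $\mathbb{R}^3$ with surface $x^2/\ell_1^2+y^2/\ell_2^2+(z-z_0)^2/\ell_3^2=1$ (in degenerate cases, the surface is the set $\{(\ell_1n_1,\ell_2n_2,z_0+\ell_3n_3): n_1^2+n_2^2+n_3^2=1\}$); it lies in the closed unit ball. The ellipse $\mathbf{E}$ is the section $y=0$ of the surface, $x^2/\ell_1^2+(z-z_0)^2/\ell_3^2=1$ (in degenerate cases $\{(\ell_1 n_1,z_0+\ell_3 n_3): n_1^2+n_3^2=1\}$). Put $z_G=z_0+\ell_3$, $z_H=z_0-\ell_3$; $G=(0,z_G)$ and $H=(0,z_H)$ are the upper and lower vertices of $\mathbf{E}$. The reduced state $\rho^B$ has Bloch vector $B=(0,0,z_B)$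 with $z_B=a-b+c-d$. Let $h(x)=-\frac{1+x}{2}\log_2\frac{1+x}{2}-\frac{1-x}{2}\log_2\frac{1-x}{2}$ for $x\in[0,1]$ (with $0\log_2 0=0$). A point $X$ at distance $|OX|$ from the origin represents a qubit state with von Neumann entropy $S_X=h(|OX|)$. A decomposition of $\rho^B$ is an expression of $B$ as a finite convex combination $B=\sum_ip_iB_i$ of points $B_i$ on the surface of $\mathfrak{E}$ (these are the post-measurement ensembles of qubit $B$ obtained from rank-1 POVMs on $A$). Its average entropy is $\sum_ip_iS_{B_i}$. A decomposition is optimal if it attains the minimum $\overline{S}^B_{\min}$ of the average entropy over all decompositions of $\rho^B$. The horizontal decomposition of $\rho^B$ is the one, with weights $\frac12,\frac12$, into the two points of $\mathbf{E}$ with $z$-coordinate $z_B$. The vertical decomposition is the one into $G$ and $H$. A three-state decomposition is a decomposition (with positive weights) into three points of $\mathbf{E}$ that are either $G$ together with the two points of $\mathbf{E}$ having $z$-coordinate $z_1$ for some $z_1\in(z_H,z_B)$, the latter two with equal weights (upper-triangle), or $H$ together with the two points of $\mathbf{E}$ having $z$-coordinate $z_2$ for some $z_2\in(z_B,z_G)$, the latter two with equal weights (lower-triangle). *)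

theory Defs
  imports "HOL-Analysis.Analysis"
begin

(* Operators on the two-qubit space are complex^4^4; the indices 1, 2, 3, 4 stand for the
   product basis vectors |00>, |01>, |10>, |11> (first factor A, second factor B). *)

definition x_matrix :: "real \<Rightarrow> real \<Rightarrow> real \<Rightarrow> real \<Rightarrow> real \<Rightarrow> real \<Rightarrow> complex^4^4" where
  "x_matrix a b c d u v =
     (\<chi> i j. if i = 1 \<and> j = 1 then of_real a
            else if i = 2 \<and> j = 2 then of_real b
            else if i = 3 \<and> j = 3 then of_real c
            else if i = 4 \<and> j = 4 then of_real d
            else if i = 1 \<and> j = 4 \<or> i = 4 \<and> j = 1 then of_real u
            else if i = 2 \<and> j = 3 \<or> i = 3 \<and> j = 2 then of_real v
            else 0)"

definition x_state :: "complex^4^4 \<Rightarrow> bool" where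
  "x_state \<rho> \<longleftrightarrow> (\<exists>a b c d u v.
     0 \<le> a \<and> 0 \<le> b \<and> 0 \<le> c \<and> 0 \<le> d \<and> a + b + c + d = 1 \<and>
     0 \<le> u \<and> 0 \<le> v \<and> u\<^sup>2 \<le> a * d \<and> v\<^sup>2 \<le> b * c \<and> (a + b) * (c + d) > 0 \<and>
     \<rho> = x_matrix a b c d u v)"

definition ent_a :: "complex^4^4 \<Rightarrow> real" where "ent_a \<rho> = Re (\<rho> $ 1 $ 1)"
definition ent_b :: "complex^4^4 \<Rightarrow> real" where "ent_b \<rho> = Re (\<rho> $ 2 $ 2)"
definition ent_c :: "complex^4^4 \<Rightarrow> real" where "ent_c \<rho> = Re (\<rho> $ 3 $ 3)"
definition ent_d :: "complex^4^4 \<Rightarrow> real" where "ent_d \<rho> = Re (\<rho> $ 4 $ 4)"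
definition ent_u :: "complex^4^4 \<Rightarrow> real" where "ent_u \<rho> = Re (\<rho> $ 1 $ 4)"
definition ent_v :: "complex^4^4 \<Rightarrow> real" where "ent_v \<rho> = Re (\<rho> $ 2 $ 3)"

lemma ent_x_matrix [simp]:
  "ent_a (x_matrix a b c d u v) = a" "ent_b (x_matrix a b c d u v) = b"
  "ent_c (x_matrix a b c d u v) = c" "ent_d (x_matrix a b c d u v) = d"
  "ent_u (x_matrix a b c d u v) = u" "ent_v (x_matrix a b c d u v) = v"
  by (simp_all add: x_matrix_def ent_a_def ent_b_def ent_c_def ent_d_def ent_u_def ent_v_def)

(* The partial trace over A, and the Bloch vector r of (1 + r . sigma) / 2. *)

definition reduced_B :: "complex^4^4 \<Rightarrow> complex^2^2" where
  "reduced_B \<rho> = vector [vector [\<rho> $ 1 $ 1 + \<rho> $ 3 $ 3, \<rho> $ 1 $ 2 + \<rho> $ 3 $ 4],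
                         vector [\<rho> $ 2 $ 1 + \<rho> $ 4 $ 3, \<rho> $ 2 $ 2 + \<rho> $ 4 $ 4]]"

definition bloch_vector :: "complex^2^2 \<Rightarrow> real^3" where
  "bloch_vector \<tau> = vector [2 * Re (\<tau> $ 2 $ 1), 2 * Im (\<tau> $ 2 $ 1), Re (\<tau> $ 1 $ 1) - Re (\<tau> $ 2 $ 2)]"

definition bloch_B :: "complex^4^4 \<Rightarrow> real^3" where
  "bloch_B \<rho> = bloch_vector (reduced_B \<rho>)"

definition z_B :: "complex^4^4 \<Rightarrow> real" where
  "z_B \<rho> = ent_a \<rho> - ent_b \<rho> + ent_c \<rho> - ent_d \<rho>"

lemma bloch_B_x_matrix:
  "bloch_B (x_matrix a b c d u v) = vector [0, 0, a - b + c - d]"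
  by (simp add: bloch_B_def bloch_vector_def reduced_B_def x_matrix_def algebra_simps)

lemma bloch_B_x_state: "x_state \<rho> \<Longrightarrow> bloch_B \<rho> = vector [0, 0, z_B \<rho>]"
  by (auto simp: x_state_def bloch_B_x_matrix z_B_def)

definition norm_AB :: "complex^4^4 \<Rightarrow> real" where
  "norm_AB \<rho> = (ent_a \<rho> + ent_b \<rho>) * (ent_c \<rho> + ent_d \<rho>)"

definition ell1 :: "complex^4^4 \<Rightarrow> real" where
  "ell1 \<rho> = (ent_u \<rho> + ent_v \<rho>) / sqrt (norm_AB \<rho>)"

definition ell2 :: "complex^4^4 \<Rightarrow> real" where
  "ell2 \<rho> = \<bar>ent_u \<rho> - ent_v \<rho>\<bar> / sqrt (norm_AB \<rho>)"

definition ell3 :: "complex^4^4 \<Rightarrow> real" where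
  "ell3 \<rho> = \<bar>ent_a \<rho> * ent_d \<rho> - ent_b \<rho> * ent_c \<rho>\<bar> / norm_AB \<rho>"

definition z_0 :: "complex^4^4 \<Rightarrow> real" where
  "z_0 \<rho> = (ent_a \<rho> * ent_c \<rho> - ent_b \<rho> * ent_d \<rho>) / norm_AB \<rho>"

definition z_G :: "complex^4^4 \<Rightarrow> real" where "z_G \<rho> = z_0 \<rho> + ell3 \<rho>"
definition z_H :: "complex^4^4 \<Rightarrow> real" where "z_H \<rho> = z_0 \<rho> - ell3 \<rho>"

(* The steering ellipsoid is represented by its surface, which determines it. The
   parametrisation covers the degenerate cases; see steering_ellipsoid_quadric for the others. *)

definition steering_ellipsoid :: "complex^4^4 \<Rightarrow> (real^3) set" where
  "steering_ellipsoid \<rho> =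
     {vector [ell1 \<rho> * n1, ell2 \<rho> * n2, z_0 \<rho> + ell3 \<rho> * n3] | n1 n2 n3.
        n1\<^sup>2 + n2\<^sup>2 + n3\<^sup>2 = 1}"

lemma vec3_eq_iff: "(P :: real^3) = vector [x, y, z] \<longleftrightarrow> P $ 1 = x \<and> P $ 2 = y \<and> P $ 3 = z"
  by (auto simp: vec_eq_iff forall_3)

lemma steering_ellipsoid_quadric:
  assumes "ell1 \<rho> \<noteq> 0" "ell2 \<rho> \<noteq> 0" "ell3 \<rho> \<noteq> 0"
  shows "steering_ellipsoid \<rho> =
    {P. (P $ 1)\<^sup>2 / (ell1 \<rho>)\<^sup>2 + (P $ 2)\<^sup>2 / (ell2 \<rho>)\<^sup>2 + (P $ 3 - z_0 \<rho>)\<^sup>2 / (ell3 \<rho>)\<^sup>2 = 1}"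
  (is "?L = ?R")
proof (intro set_eqI iffI)
  fix P assume "P \<in> ?L"
  then show "P \<in> ?R"
    using assms by (auto simp: steering_ellipsoid_def power_mult_distrib)
next
  fix P assume P: "P \<in> ?R"
  show "P \<in> ?L"
    unfolding steering_ellipsoid_def mem_Collect_eq vec3_eq_iff
    by (rule exI[of _ "P $ 1 / ell1 \<rho>"], rule exI[of _ "P $ 2 / ell2 \<rho>"],
        rule exI[of _ "(P $ 3 - z_0 \<rho>) / ell3 \<rho>"])
       (use P assms in \<open>simp add: power_divide\<close>)
qed

(* Points (x, z) of the plane y = 0 are written as (x, 0, z). *)

definition ellipse :: "complex^4^4 \<Rightarrow> (real^3) set" where
  "ellipse \<rho> = {vector [ell1 \<rho> * n1, 0, z_0 \<rho> + ell3 \<rho> * n3] | n1 n3. n1\<^sup>2 + n3\<^sup>2 = 1}"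

definition vertex_G :: "complex^4^4 \<Rightarrow> real^3" where "vertex_G \<rho> = vector [0, 0, z_G \<rho>]"
definition vertex_H :: "complex^4^4 \<Rightarrow> real^3" where "vertex_H \<rho> = vector [0, 0, z_H \<rho>]"

(* The two points of the ellipse at height z; see ellipse_at_height. If ell3 = 0 the ellipse is
   a horizontal segment at height z_0; division by zero being zero, these are then its
   end points, that is, the horizontal vertices of the degenerate ellipse. *)

definition half_width :: "complex^4^4 \<Rightarrow> real \<Rightarrow> real" where
  "half_width \<rho> z = ell1 \<rho> * sqrt (1 - ((z - z_0 \<rho>) / ell3 \<rho>)\<^sup>2)"

definition right_point :: "complex^4^4 \<Rightarrow> real \<Rightarrow> real^3" where
  "right_point \<rho> z = vector [half_width \<rho> z, 0, z]"

definition left_point :: "complex^4^4 \<Rightarrow> real \<Rightarrow> real^3" where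
  "left_point \<rho> z = vector [- half_width \<rho> z, 0, z]"

lemma ellipse_at_height:
  assumes "ell3 \<rho> > 0" "z_H \<rho> \<le> z" "z \<le> z_G \<rho>"
  shows "{P \<in> ellipse \<rho>. P $ 3 = z} = {right_point \<rho> z, left_point \<rho> z}"
proof -
  define m where "m = (z - z_0 \<rho>) / ell3 \<rho>"
  define s where "s = sqrt (1 - m\<^sup>2)"
  have z: "z = z_0 \<rho> + ell3 \<rho> * m" using assms(1) by (simp add: m_def)
  have "\<bar>m\<bar> \<le> 1"
    using assms by (simp add: m_def z_G_def z_H_def abs_le_iff field_simps)
  then have "m\<^sup>2 \<le> 1" by (simp add: abs_square_le_1)
  then have s2: "s\<^sup>2 = 1 - m\<^sup>2" by (simp add: s_def)
  have w: "half_width \<rho> z = ell1 \<rho> * s" by (simp add: half_width_def s_def m_def)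
  show ?thesis
  proof (intro set_eqI iffI)
    fix P assume "P \<in> {P \<in> ellipse \<rho>. P $ 3 = z}"
    then obtain n1 n3 where n: "n1\<^sup>2 + n3\<^sup>2 = 1" "P = vector [ell1 \<rho> * n1, 0, z_0 \<rho> + ell3 \<rho> * n3]"
      "P $ 3 = z" by (auto simp: ellipse_def)
    then have "n3 = m" using assms(1) z by simp
    then have "n1\<^sup>2 = s\<^sup>2" using n s2 by simp
    then have "n1 = s \<or> n1 = - s" by (simp add: power2_eq_iff)
    then show "P \<in> {right_point \<rho> z, left_point \<rho> z}"
      using n w \<open>n3 = m\<close> z by (auto simp: right_point_def left_point_def)
  next
    fix P assume "P \<in> {right_point \<rho> z, left_point \<rho> z}"
    then obtain t where t: "t = s \<or> t = - s" "P = vector [ell1 \<rho> * t, 0, z]"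
      using w that[of s] that[of "- s"] by (auto simp: right_point_def left_point_def)
    then have "t\<^sup>2 + m\<^sup>2 = 1" using s2 by auto
    then show "P \<in> {P \<in> ellipse \<rho>. P $ 3 = z}"
      using t z by (auto simp: ellipse_def)
  qed
qed

(* 0 * log 2 0 = 0 holds in HOL. *)

definition bin_entropy :: "real \<Rightarrow> real" where
  "bin_entropy x = - ((1 + x) / 2 * log 2 ((1 + x) / 2)) - (1 - x) / 2 * log 2 ((1 - x) / 2)"

definition entropy :: "real^3 \<Rightarrow> real" where
  "entropy X = bin_entropy (norm X)"

(* A decomposition is a finite list of (weight, point) pairs. *)

definition decomposition :: "complex^4^4 \<Rightarrow> (real \<times> (real^3)) list \<Rightarrow> bool" where
  "decomposition \<rho> D \<longleftrightarrow>
     (\<forall>(p, X) \<in> set D. 0 \<le> p \<and> X \<in> steering_ellipsoid \<rho>) \<and>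
     (\<Sum>(p, X)\<leftarrow>D. p) = 1 \<and> (\<Sum>(p, X)\<leftarrow>D. p *\<^sub>R X) = bloch_B \<rho>"

definition average_entropy :: "(real \<times> (real^3)) list \<Rightarrow> real" where
  "average_entropy D = (\<Sum>(p, X)\<leftarrow>D. p * entropy X)"

definition optimal :: "complex^4^4 \<Rightarrow> (real \<times> (real^3)) list \<Rightarrow> bool" where
  "optimal \<rho> D \<longleftrightarrow> decomposition \<rho> D \<and>
     (\<forall>D'. decomposition \<rho> D' \<longrightarrow> average_entropy D \<le> average_entropy D')"

definition horizontal_decomposition :: "complex^4^4 \<Rightarrow> (real \<times> (real^3)) list" where
  "horizontal_decomposition \<rho> =
     [(1 / 2, right_point \<rho> (z_B \<rho>)), (1 / 2, left_point \<rho> (z_B \<rho>))]"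

(* The weights are forced by the barycentre, unless the two vertices coincide. *)

definition vertical_decomposition :: "complex^4^4 \<Rightarrow> (real \<times> (real^3)) list \<Rightarrow> bool" where
  "vertical_decomposition \<rho> D \<longleftrightarrow> decomposition \<rho> D \<and>
     (\<exists>p q. D = [(p, vertex_G \<rho>), (q, vertex_H \<rho>)])"

definition upper_triangle :: "complex^4^4 \<Rightarrow> (real \<times> (real^3)) list \<Rightarrow> bool" where
  "upper_triangle \<rho> D \<longleftrightarrow> decomposition \<rho> D \<and>
     (\<exists>p q z\<^sub>1. 0 < p \<and> 0 < q \<and> z_H \<rho> < z\<^sub>1 \<and> z\<^sub>1 < z_B \<rho> \<and>
        D = [(p, vertex_G \<rho>), (q, right_point \<rho> z\<^sub>1), (q, left_point \<rho> z\<^sub>1)])"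

definition lower_triangle :: "complex^4^4 \<Rightarrow> (real \<times> (real^3)) list \<Rightarrow> bool" where
  "lower_triangle \<rho> D \<longleftrightarrow> decomposition \<rho> D \<and>
     (\<exists>p q z\<^sub>2. 0 < p \<and> 0 < q \<and> z_B \<rho> < z\<^sub>2 \<and> z\<^sub>2 < z_G \<rho> \<and>
        D = [(p, vertex_H \<rho>), (q, right_point \<rho> z\<^sub>2), (q, left_point \<rho> z\<^sub>2)])"

definition three_state_decomposition :: "complex^4^4 \<Rightarrow> (real \<times> (real^3)) list \<Rightarrow> bool" where
  "three_state_decomposition \<rho> D \<longleftrightarrow>
     distinct (map snd D) \<and> (upper_triangle \<rho> D \<or> lower_triangle \<rho> D)"

definition states_with_ellipsoid :: "(real^3) set \<Rightarrow> (complex^4^4) set" where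
  "states_with_ellipsoid \<EE> = {\<rho>. x_state \<rho> \<and> steering_ellipsoid \<rho> = \<EE>}"

definition horizontal_optimal :: "complex^4^4 \<Rightarrow> bool" where
  "horizontal_optimal \<rho> \<longleftrightarrow> optimal \<rho> (horizontal_decomposition \<rho>)"

definition vertical_optimal :: "complex^4^4 \<Rightarrow> bool" where
  "vertical_optimal \<rho> \<longleftrightarrow> (\<exists>D. vertical_decomposition \<rho> D \<and> optimal \<rho> D)"

definition optimal_three_state :: "complex^4^4 \<Rightarrow> (real \<times> (real^3)) list \<Rightarrow> bool" where
  "optimal_three_state \<rho> D \<longleftrightarrow> three_state_decomposition \<rho> D \<and> optimal \<rho> D"

definition type_horizontal :: "(real^3) set \<Rightarrow> bool" where
  "type_horizontal \<EE> \<longleftrightarrow> (\<forall>\<rho> \<in> states_with_ellipsoid \<EE>. horizontal_optimal \<rho>)"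

definition type_vertical :: "(real^3) set \<Rightarrow> bool" where
  "type_vertical \<EE> \<longleftrightarrow> (\<forall>\<rho> \<in> states_with_ellipsoid \<EE>. vertical_optimal \<rho>)"

definition type_triangle :: "(real^3) set \<Rightarrow> bool" where
  "type_triangle \<EE> \<longleftrightarrow>
     (\<exists>\<rho> \<in> states_with_ellipsoid \<EE>. horizontal_optimal \<rho>) \<and>
     (\<exists>\<rho> \<in> states_with_ellipsoid \<EE>. \<not> horizontal_optimal \<rho>) \<and>
     (\<exists>B\<^sub>1 B\<^sub>2 B\<^sub>3.
        \<forall>\<rho> \<in> states_with_ellipsoid \<EE>. {B\<^sub>1, B\<^sub>2, B\<^sub>3} \<subseteq> ellipse \<rho> \<and>
          (\<not> horizontal_optimal \<rho> \<longrightarrow>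
             (\<exists>D. optimal_three_state \<rho> D) \<and>
             (\<forall>D. optimal_three_state \<rho> D \<longrightarrow> snd ` set D = {B\<^sub>1, B\<^sub>2, B\<^sub>3})))"

end

(* A point of the ellipsoid at height z is at most as far from the origin as the points of the
   ellipse at that height, so only F(z), the entropy on the ellipse at height z, matters, and the
   minimal average entropy is the lower convex envelope of F on [z_H, z_G], evaluated at z_B. The
   squared distance from the origin is a quadratic polynomial in z. If it is convex, then F is
   concave, since the entropy is a decreasing concave function of the squared distance, and the
   envelope is the chord. If it is a downward parabola with apex (w, M), then F'' has the sign of
   1 - M * psi, where psi is an increasing function of the distance with values below 1. For
   M <= 1 this makes F convex. For M > 1 the apex lies outside [z_H, z_G], because the ellipsoid
   lies in the unit ball; so the distance is monotone in z, F is convex on one side of a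
   point and concave on the other, and its envelope is F, a chord, or F followed by the segment
   of a tangent that ends at a vertex. None of this depends on z_B, the only parameter in which the
   states with a given ellipsoid differ for the problem at hand. *)

theory Submission
  imports Defs
begin

section \<open>Binary entropy\<close>

text \<open>Optimality is certified by duality: a line below F bounds every average entropy from
  below by its value at \<open>z_B\<close>, and a decomposition attains the bound when its points
  have the entropy F of their heights and these heights are contact points of the line with F. In
  the tangent case the line touches F at one interior height and one vertex and nowhere else; this
  strictness is what fixes the three components. The obstacle is the infinite slope of the entropy
  at pure states, which occur whenever the ellipsoid touches the unit sphere. Derivatives are
  therefore used only inside open intervals, and end points are reached by continuity. No support
  line at a vertex is required, because \<open>z_B\<close> lies strictly between the vertices unless
  they coincide. The function psi arises from the entropy as a function of t = x^2: its second
  derivative is a negative multiple of psi(x) / (1 - t). Along a parabola the chain rule adds a term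
  with the first derivative, and the sum collapses to a multiple of 1 - M * psi(x). That the
  ellipsoid lies in the unit ball is derived here from the positivity constraints on the
  state.\<close>

lemma continuous_on_mult_log: "continuous_on {0..} (\<lambda>x::real. x * log 2 x)"
  unfolding continuous_on_eq_continuous_within
proof
  fix x :: real assume "x \<in> {0..}"
  show "continuous (at x within {0..}) (\<lambda>x. x * log 2 x)"
  proof (cases "x = 0")
    \<comment> \<open>At 0 the substitution x = 1 / y turns the function into -ln y / (y ln 2) with
      y tending to infinity.\<close>
    case True
    have "((\<lambda>x::real. x * log 2 x) \<longlongrightarrow> 0) (at_right 0)"
    proof -
      have "((\<lambda>y::real. - (ln y / y) / ln 2) \<longlongrightarrow> - 0 / ln 2) at_top"
        by (intro tendsto_intros ln_x_over_x_tendsto_0) auto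
      moreover have "(\<lambda>y::real. - (ln y / y) / ln 2) = (\<lambda>y. inverse y * log 2 (inverse y))"
        by (simp add: log_def ln_inverse divide_inverse mult_ac)
      ultimately have "((\<lambda>y::real. inverse y * log 2 (inverse y)) \<longlongrightarrow> 0) at_top"
        by simp
      then show ?thesis
        by (simp add: filterlim_at_right_to_top)
    qed
    then show ?thesis
      using True by (simp add: continuous_within at_within_Ici_at_right)
  next
    case False
    with \<open>x \<in> {0..}\<close> have "isCont (\<lambda>x. x * log 2 x) x"
      by (intro continuous_intros) auto
    then show ?thesis
      by (rule continuous_at_imp_continuous_within)
  qed
qed

lemma continuous_on_bin_entropy: "continuous_on {0..1} bin_entropy"
proof -
  have "continuous_on {0..1} (\<lambda>x::real. (1 + x) / 2 * log 2 ((1 + x) / 2))"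
    by (rule continuous_on_compose2[OF continuous_on_mult_log, of _ "\<lambda>x. (1 + x) / 2"])
      (auto intro!: continuous_intros)
  moreover have "continuous_on {0..1} (\<lambda>x::real. (1 - x) / 2 * log 2 ((1 - x) / 2))"
    by (rule continuous_on_compose2[OF continuous_on_mult_log, of _ "\<lambda>x. (1 - x) / 2"])
      (auto intro!: continuous_intros)
  ultimately show ?thesis
    unfolding bin_entropy_def by (intro continuous_on_diff continuous_on_minus)
qed

text \<open>The constants 1 / ln 2 from the two halves cancel and leave half a difference of
  logarithms, which is artanh. It diverges at x = 1, the source of all the care taken at pure
  states.\<close>

lemma DERIV_bin_entropy:
  assumes "0 \<le> x" "x < 1"
  shows "(bin_entropy has_real_derivative - artanh x / ln 2) (at x)"
proof -
  have D: "((\<lambda>x. x * log 2 x) has_real_derivative log 2 y + 1 / ln 2) (at y)" if "0 < y" for y :: real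
  proof -
    have "((\<lambda>x. x * log 2 x) has_real_derivative 1 * log 2 y + 1 / (ln 2 * y) * y) (at y)"
      using that by (intro DERIV_mult DERIV_ident DERIV_log)
    then show ?thesis using that by simp
  qed
  have "((\<lambda>x. (1 + x) / 2 * log 2 ((1 + x) / 2)) has_real_derivative
      (log 2 ((1 + x) / 2) + 1 / ln 2) * (1 / 2)) (at x)"
    using assms by (intro DERIV_chain2[OF D, of "\<lambda>x. (1 + x) / 2"])
      (auto intro!: derivative_eq_intros)
  moreover have "((\<lambda>x. (1 - x) / 2 * log 2 ((1 - x) / 2)) has_real_derivative
      (log 2 ((1 - x) / 2) + 1 / ln 2) * (- 1 / 2)) (at x)"
    using assms by (intro DERIV_chain2[OF D, of "\<lambda>x. (1 - x) / 2"])
      (auto intro!: derivative_eq_intros)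
  ultimately have "((\<lambda>x. - ((1 + x) / 2 * log 2 ((1 + x) / 2)) - (1 - x) / 2 * log 2 ((1 - x) / 2))
      has_real_derivative - ((log 2 ((1 + x) / 2) + 1 / ln 2) * (1 / 2))
        - (log 2 ((1 - x) / 2) + 1 / ln 2) * (- 1 / 2)) (at x)"
    by (intro DERIV_diff DERIV_minus)
  moreover have "- ((log 2 ((1 + x) / 2) + 1 / ln 2) * (1 / 2))
        - (log 2 ((1 - x) / 2) + 1 / ln 2) * (- 1 / 2) = - artanh x / ln 2"
  proof -
    have "artanh x = (ln (1 + x) - ln (1 - x)) / 2"
      "ln ((1 + x) / 2) = ln (1 + x) - ln 2" "ln ((1 - x) / 2) = ln (1 - x) - ln 2"
      using assms by (simp_all add: artanh_def ln_div)
    then show ?thesis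
      by (simp only: log_def) (simp add: field_simps)
  qed
  ultimately show ?thesis
    by (simp add: bin_entropy_def[abs_def])
qed

section \<open>Elementary bounds on artanh and the resulting bounds on the curvature ratio\<close>

lemma artanh_gt_self:
  assumes "0 < x" "x < (1::real)"
  shows "x < artanh x"
proof -
  have "(\<lambda>x. artanh x - x) 0 < (\<lambda>x. artanh x - x) x"
  proof (rule DERIV_pos_imp_increasing_open[where f = "\<lambda>x. artanh x - x"])
    fix y assume y: "0 < y" "y < x"
    then have "y\<^sup>2 < 1" using assms by (simp add: abs_square_less_1)
    with y assms show "\<exists>d. ((\<lambda>x. artanh x - x) has_real_derivative d) (at y) \<and> 0 < d"
      by (intro exI[of _ "1 / (1 - y\<^sup>2) - 1"]) (auto intro!: derivative_eq_intros simp: field_simps)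
  qed (use assms in \<open>auto intro!: continuous_intros\<close>)
  then show ?thesis by simp
qed

text \<open>The gap vanishes at 0 and has derivative 2 y^2 / (1 - y^2)^2. The bound is exactly the
  positivity of \<open>curv_ratio\<close>.\<close>

lemma artanh_less:
  assumes "0 < x" "x < (1::real)"
  shows "artanh x < x / (1 - x\<^sup>2)"
proof -
  have "(\<lambda>x. x / (1 - x\<^sup>2) - artanh x) 0 < (\<lambda>x. x / (1 - x\<^sup>2) - artanh x) x"
  proof (rule DERIV_pos_imp_increasing_open[where f = "\<lambda>x. x / (1 - x\<^sup>2) - artanh x"])
    fix y assume y: "0 < y" "y < x"
    then have y2: "y\<^sup>2 < 1" using assms by (simp add: abs_square_less_1)
    have "((\<lambda>x. x / (1 - x\<^sup>2) - artanh x) has_real_derivative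
        (1 * (1 - y\<^sup>2) + y * (2 * y)) / (1 - y\<^sup>2)\<^sup>2 - 1 / (1 - y\<^sup>2)) (at y)"
      using y y2 assms by (auto intro!: derivative_eq_intros simp: power2_eq_square)
    moreover have "(1 * (1 - y\<^sup>2) + y * (2 * y)) / (1 - y\<^sup>2)\<^sup>2 - 1 / (1 - y\<^sup>2)
        = 2 * y\<^sup>2 / (1 - y\<^sup>2)\<^sup>2"
      using y2 by (simp add: divide_simps) (simp add: algebra_simps power2_eq_square)
    moreover have "0 < 2 * y\<^sup>2 / (1 - y\<^sup>2)\<^sup>2"
      using y y2 by simp
    ultimately show "\<exists>d. ((\<lambda>x. x / (1 - x\<^sup>2) - artanh x) has_real_derivative d) (at y) \<and> 0 < d"
      by (intro exI conjI) (assumption, simp only:)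
  next
    have "y\<^sup>2 \<noteq> 1" if "y \<in> {0..x}" for y
      using that assms by (auto simp: power2_eq_1_iff)
    then show "continuous_on {0..x} (\<lambda>x. x / (1 - x\<^sup>2) - artanh x)"
      using assms by (auto intro!: continuous_intros)
  qed (use assms in auto)
  then show ?thesis by simp
qed

text \<open>The fraction 3 x / (3 - x^2) is a Pade approximant of artanh at 0, and the difference
  has derivative 4 y^4 / ((1 - y^2) (3 - y^2)^2). The bound is the one that the derivative of
  \<open>curv_ratio\<close> calls for.\<close>

lemma artanh_greater:
  assumes "0 < x" "x < (1::real)"
  shows "3 * x < (3 - x\<^sup>2) * artanh x"
proof -
  have *: "y\<^sup>2 < 1" if "0 \<le> y" "y \<le> x" for y
    using that assms by (simp add: abs_square_less_1)
  have "(\<lambda>x. artanh x - 3 * x / (3 - x\<^sup>2)) 0 < (\<lambda>x. artanh x - 3 * x / (3 - x\<^sup>2)) x"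
  proof (rule DERIV_pos_imp_increasing_open[where f = "\<lambda>x. artanh x - 3 * x / (3 - x\<^sup>2)"])
    fix y assume y: "0 < y" "y < x"
    then have y2: "y\<^sup>2 < 1" using * by simp
    have "((\<lambda>x. artanh x - 3 * x / (3 - x\<^sup>2)) has_real_derivative
        1 / (1 - y\<^sup>2) - (3 * (3 - y\<^sup>2) + 3 * y * (2 * y)) / (3 - y\<^sup>2)\<^sup>2) (at y)"
      using y y2 assms by (auto intro!: derivative_eq_intros simp: power2_eq_square)
    moreover have "1 / (1 - y\<^sup>2) - (3 * (3 - y\<^sup>2) + 3 * y * (2 * y)) / (3 - y\<^sup>2)\<^sup>2
        = 4 * (y\<^sup>2)\<^sup>2 / ((1 - y\<^sup>2) * (3 - y\<^sup>2)\<^sup>2)"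
      using y2 by (simp add: divide_simps) (simp add: algebra_simps eval_nat_numeral)
    moreover have "0 < 4 * (y\<^sup>2)\<^sup>2 / ((1 - y\<^sup>2) * (3 - y\<^sup>2)\<^sup>2)"
      using y y2 by simp
    ultimately show "\<exists>d. ((\<lambda>x. artanh x - 3 * x / (3 - x\<^sup>2)) has_real_derivative d) (at y) \<and> 0 < d"
      by (intro exI conjI) (assumption, simp only:)
  next
    have "3 - y\<^sup>2 \<noteq> 0" if "y \<in> {0..x}" for y
      using *[of y] that by auto
    then show "continuous_on {0..x} (\<lambda>x. artanh x - 3 * x / (3 - x\<^sup>2))"
      using assms by (auto intro!: continuous_intros)
  qed (use assms in auto)
  moreover have "0 < 3 - x\<^sup>2" using *[of x] assms by simp
  ultimately show ?thesis by (simp add: field_simps)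
qed

text \<open>The second derivative of the entropy along a parabola of squared distances with maximum \<open>M\<close>
  is a positive multiple of \<open>1 - M * curv_ratio x\<close> at distance \<open>x\<close>.\<close>

definition curv_ratio :: "real \<Rightarrow> real" where
  "curv_ratio x = (x - (1 - x\<^sup>2) * artanh x) / x ^ 3"

lemma curv_ratio_less_1:
  assumes "0 < x" "x < 1"
  shows "curv_ratio x < 1"
proof -
  have "0 < 1 - x\<^sup>2" using assms by (simp add: abs_square_less_1)
  then have "(1 - x\<^sup>2) * x < (1 - x\<^sup>2) * artanh x"
    using artanh_gt_self[OF assms] by simp
  then have "x - (1 - x\<^sup>2) * artanh x < x ^ 3"
    by (simp add: algebra_simps power2_eq_square power3_eq_cube)
  then show ?thesis using assms by (simp add: curv_ratio_def)
qed

text \<open>The quotient rule leaves the numerator (3 - t^2) artanh t - 3 t over t^4, which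
  \<open>artanh_greater\<close> makes positive.\<close>

lemma curv_ratio_strict_mono:
  assumes "0 < x" "x < y" "y < 1"
  shows "curv_ratio x < curv_ratio y"
proof (rule DERIV_pos_imp_increasing[OF \<open>x < y\<close>])
  fix t assume "x \<le> t" "t \<le> y"
  then have t: "0 < t" "t < 1" using assms by auto
  then have "t\<^sup>2 < 1" by (simp add: abs_square_less_1)
  then have "((\<lambda>x. (x - (1 - x\<^sup>2) * artanh x) / x ^ 3) has_real_derivative
      ((1 - (1 - 2 * t * artanh t)) * t ^ 3
        - (t - (1 - t\<^sup>2) * artanh t) * (3 * t\<^sup>2)) / (t ^ 3 * t ^ 3)) (at t)"
    using t \<open>t\<^sup>2 < 1\<close> by (auto intro!: derivative_eq_intros)
  moreover have "((1 - (1 - 2 * t * artanh t)) * t ^ 3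
        - (t - (1 - t\<^sup>2) * artanh t) * (3 * t\<^sup>2)) / (t ^ 3 * t ^ 3)
      = ((3 - t\<^sup>2) * artanh t - 3 * t) / t ^ 4"
    using t \<open>t\<^sup>2 < 1\<close> by (simp add: divide_simps) (simp add: algebra_simps eval_nat_numeral)
  moreover have "0 < ((3 - t\<^sup>2) * artanh t - 3 * t) / t ^ 4"
    using artanh_greater[OF t] t by simp
  ultimately show "\<exists>d. (curv_ratio has_real_derivative d) (at t) \<and> 0 < d"
    unfolding curv_ratio_def[abs_def] by (intro exI conjI) (assumption, simp only:)
qed

section \<open>Convex envelopes of functions with one inflection\<close>

text \<open>Affine minorants serve as dual certificates, so the convex envelope never has to be
  constructed.\<close>

definition minorant :: "real set \<Rightarrow> (real \<Rightarrow> real) \<Rightarrow> real \<Rightarrow> real \<Rightarrow> bool" where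
  "minorant S f c d \<longleftrightarrow> (\<forall>x\<in>S. c + d * x \<le> f x)"

text \<open>The function meets its convex envelope at \<open>x\<close>, with a support line of
  finite slope.\<close>

definition supported :: "real set \<Rightarrow> (real \<Rightarrow> real) \<Rightarrow> real \<Rightarrow> bool" where
  "supported S f x \<longleftrightarrow> (\<exists>c d. minorant S f c d \<and> f x = c + d * x)"

definition chord_optimal :: "real \<Rightarrow> real \<Rightarrow> (real \<Rightarrow> real) \<Rightarrow> bool" where
  "chord_optimal p q f \<longleftrightarrow>
     (\<exists>c d. minorant {p..q} f c d \<and> f p = c + d * p \<and> f q = c + d * q)"

text \<open>The convex envelope of \<open>f\<close> agrees with \<open>f\<close> between \<open>t\<close> and one end point and is the chord
  between \<open>t\<close> and the other end point \<open>e\<close>.\<close>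

definition tangent_optimal :: "real \<Rightarrow> real \<Rightarrow> (real \<Rightarrow> real) \<Rightarrow> bool" where
  "tangent_optimal p q f \<longleftrightarrow>
     (\<exists>t\<in>{p<..<q}. \<exists>e\<in>{p, q}. \<exists>c d. f t = c + d * t \<and> f e = c + d * e \<and>
        (\<forall>x\<in>{p..q} - {t, e}. c + d * x < f x) \<and>
        (\<forall>x\<in>{p<..<q} - open_segment t e. supported {p..q} f x))"

lemma supportedI:
  assumes "\<And>y. y \<in> S \<Longrightarrow> f x + d * (y - x) \<le> f y"
  shows "supported S f x"
  unfolding supported_def minorant_def
  by (rule exI[of _ "f x - d * x"], rule exI[of _ d]) (use assms in \<open>force simp: algebra_simps\<close>)

lemma MVT_D:
  fixes f :: "real \<Rightarrow> real"
  assumes "a < b" "continuous_on {a..b} f"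
    and "\<And>x. \<lbrakk>a < x; x < b\<rbrakk> \<Longrightarrow> (f has_real_derivative f' x) (at x)"
  obtains x where "a < x" "x < b" "f b - f a = (b - a) * f' x"
proof -
  obtain l x where "a < x" "x < b" "DERIV f x :> l" "f b - f a = (b - a) * l"
    using MVT[OF assms(1,2)] assms(3) real_differentiable_def by blast
  with assms(3) DERIV_unique that show thesis by metis
qed

text \<open>The mean slopes on the two sides of \<open>z\<close> are values of \<open>f'\<close> at
  an earlier and a later point. The derivative is asked for only inside the interval, so the slope
  may be infinite at the ends.\<close>

lemma concave_above_chord:
  fixes f :: "real \<Rightarrow> real"
  assumes cont: "continuous_on {a..b} f"
    and deriv: "\<And>x. \<lbrakk>a < x; x < b\<rbrakk> \<Longrightarrow> (f has_real_derivative f' x) (at x)"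
    and anti: "\<And>x y. \<lbrakk>a < x; x < y; y < b\<rbrakk> \<Longrightarrow> f' y \<le> f' x"
    and z: "a \<le> z" "z \<le> b"
  shows "(b - z) * f a + (z - a) * f b \<le> (b - a) * f z"
proof (cases "a < z \<and> z < b")
  case True
  obtain x where x: "a < x" "x < z" "f z - f a = (z - a) * f' x"
    using True by (rule_tac MVT_D[of a z f f']) (auto intro: deriv continuous_on_subset[OF cont])
  obtain y where y: "z < y" "y < b" "f b - f z = (b - z) * f' y"
    using True by (rule_tac MVT_D[of z b f f']) (auto intro: deriv continuous_on_subset[OF cont])
  have "(z - a) * (b - z) * f' y \<le> (z - a) * (b - z) * f' x"
    using anti[of x y] x y True by (intro mult_left_mono) auto
  then have "(z - a) * (f b - f z) \<le> (b - z) * (f z - f a)"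
    using x(3) y(3) by (simp add: mult_ac)
  then show ?thesis by (simp add: algebra_simps)
next
  case False
  with z have "z = a \<or> z = b" by auto
  then show ?thesis by (auto simp: algebra_simps)
qed

text \<open>A subgradient at \<open>x\<close> exists on the open interval, and its inequality passes
  to the closure by continuity.\<close>

lemma supported_of_convex_on:
  fixes f :: "real \<Rightarrow> real"
  assumes "convex_on {p<..<q} f" "continuous_on {p..q} f" "p < x" "x < q"
  shows "supported {p..q} f x"
proof -
  obtain d where d: "f x + d * (y - x) \<le> f y" if "y \<in> {p<..<q}" for y
    using convex_le_Inf_differential[OF assms(1)] assms(3,4) by auto
  have "0 \<le> f y - (f x + d * (y - x))" if "y \<in> {p..q}" for y
  proof (rule continuous_ge_on_closure[of "{p<..<q}" "\<lambda>y. f y - (f x + d * (y - x))"])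
    show "continuous_on (closure {p<..<q}) (\<lambda>y. f y - (f x + d * (y - x)))"
      using assms by (auto intro!: continuous_intros)
    show "y \<in> closure {p<..<q}" using assms that by simp
  qed (use d in auto)
  then show ?thesis by (intro supportedI) force
qed

text \<open>The cases \<open>m = p\<close> and \<open>m = q\<close> are included, so a function that
  is concave or convex throughout also fits. Derivatives live on the open interval only, because the
  entropy may have infinite slope at an end.\<close>

locale convex_concave =
  fixes p q m :: real and f f' f'' :: "real \<Rightarrow> real"
  assumes pq: "p < q" and m: "p \<le> m" "m \<le> q"
    and cont: "continuous_on {p..q} f"
    and deriv: "\<And>x. \<lbrakk>p < x; x < q\<rbrakk> \<Longrightarrow> (f has_real_derivative f' x) (at x)"
    and deriv2: "\<And>x. \<lbrakk>p < x; x < q\<rbrakk> \<Longrightarrow> (f' has_real_derivative f'' x) (at x)"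
    and pos: "\<And>x. \<lbrakk>p < x; x < m\<rbrakk> \<Longrightarrow> 0 < f'' x"
    and neg: "\<And>x. \<lbrakk>m < x; x < q\<rbrakk> \<Longrightarrow> f'' x < 0"
begin

lemma cont_sub: "p \<le> a \<Longrightarrow> b \<le> q \<Longrightarrow> continuous_on {a..b} f"
  by (rule continuous_on_subset[OF cont]) auto

lemma cont': "p < a \<Longrightarrow> b < q \<Longrightarrow> continuous_on {a..b} f'"
  by (rule DERIV_atLeastAtMost_imp_continuous_on) (use deriv2 in \<open>meson order.strict_trans1 order.strict_trans2\<close>)

lemma deriv_inc: "\<lbrakk>p < x; x < y; y \<le> m; y < q\<rbrakk> \<Longrightarrow> f' x < f' y"
proof (rule DERIV_pos_imp_increasing_open[of x y f'])
  fix z assume "p < x" "y \<le> m" "y < q" "x < z" "z < y"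
  then show "\<exists>d. (f' has_real_derivative d) (at z) \<and> 0 < d"
    using deriv2[of z] pos[of z] by (intro exI[of _ "f'' z"]) auto
qed (auto intro: cont')

lemma deriv_dec: "\<lbrakk>p < x; m \<le> x; x < y; y < q\<rbrakk> \<Longrightarrow> f' y < f' x"
proof (rule DERIV_neg_imp_decreasing_open[of x y f'])
  fix z assume "p < x" "m \<le> x" "y < q" "x < z" "z < y"
  then show "\<exists>d. (f' has_real_derivative d) (at z) \<and> d < 0"
    using deriv2[of z] neg[of z] by (intro exI[of _ "f'' z"]) auto
qed (auto intro: cont')

lemma mvt:
  assumes "p \<le> a" "a < b" "b \<le> q"
  obtains x where "a < x" "x < b" "f b - f a = (b - a) * f' x"
  by (rule MVT_D[of a b f f']) (use assms in \<open>auto intro: cont_sub deriv\<close>)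

text \<open>The sign of \<open>W x\<close> tells whether the tangent at \<open>x\<close> passes above or below the right end
  point of the graph.\<close>

definition W :: "real \<Rightarrow> real" where
  "W x = f' x * (q - x) - (f q - f x)"

lemma W_pos: "\<lbrakk>p < x; m \<le> x; x < q\<rbrakk> \<Longrightarrow> 0 < W x"
proof -
  assume x: "p < x" "m \<le> x" "x < q"
  then obtain y where y: "x < y" "y < q" "f q - f x = (q - x) * f' y"
    using mvt[of x q] by auto
  then have "(q - x) * f' y < (q - x) * f' x" using deriv_dec[of x y] x by simp
  with y show ?thesis by (simp add: W_def mult.commute)
qed

lemma deriv_W: "\<lbrakk>p < x; x < q\<rbrakk> \<Longrightarrow> (W has_real_derivative f'' x * (q - x)) (at x)"
  unfolding W_def[abs_def]
  by (auto intro!: derivative_eq_intros deriv deriv2 simp: algebra_simps)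

lemma cont_W: "p < a \<Longrightarrow> b < q \<Longrightarrow> continuous_on {a..b} W"
  by (rule DERIV_atLeastAtMost_imp_continuous_on) (use deriv_W in \<open>meson order.strict_trans1 order.strict_trans2\<close>)

text \<open>The terms with \<open>f'\<close> cancel in the derivative of \<open>W\<close>, so it has
  the sign of \<open>f''\<close>. Together with \<open>W_pos\<close> this shows that
  \<open>W\<close> changes sign at most once, from negative to positive, and that a zero lies on the
  convex side.\<close>

lemma W_inc: "\<lbrakk>p < x; x < y; y \<le> m; y < q\<rbrakk> \<Longrightarrow> W x < W y"
proof (rule DERIV_pos_imp_increasing_open[of x y W])
  fix z assume "p < x" "y \<le> m" "y < q" "x < z" "z < y"
  then show "\<exists>d. (W has_real_derivative d) (at z) \<and> 0 < d"
    using deriv_W[of z] pos[of z] by (intro exI[of _ "f'' z * (q - z)"]) auto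
qed (auto intro: cont_W)

lemma above_tangent_left:
  assumes "p < x" "x \<le> m" "x < q" "p \<le> y" "y \<le> m" "y \<noteq> x"
  shows "f x + f' x * (y - x) < f y"
proof (cases "x < y")
  case True
  obtain z where z: "x < z" "z < y" "f y - f x = (y - x) * f' z"
    using mvt[of x y] True assms m by auto
  then have "(y - x) * f' x < (y - x) * f' z"
    using deriv_inc[of x z] assms m by simp
  with z show ?thesis by (simp add: algebra_simps)
next
  case False
  then have "y < x" using assms by simp
  then obtain z where z: "y < z" "z < x" "f x - f y = (x - y) * f' z"
    using mvt[of y x] assms m by auto
  then have "(x - y) * f' z < (x - y) * f' x"
    using deriv_inc[of z x] assms m by simp
  with z show ?thesis by (simp add: algebra_simps)
qed

text \<open>The gap \<open>k\<close> between graph and tangent is positive at \<open>m\<close> and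
  nonnegative at \<open>q\<close>. If it were nonpositive at some \<open>y\<close> in between, its
  derivative would be negative somewhere before \<open>y\<close> and nonnegative somewhere after,
  although \<open>f'\<close> decreases on the concave side.\<close>

lemma above_tangent_right:
  assumes "p < x" "x \<le> m" "x < q" "W x \<le> 0" "m < y" "y < q"
  shows "f x + f' x * (y - x) < f y"
proof (rule ccontr)
  assume below: "\<not> ?thesis"
  have "x < m" using W_pos[of x] assms by force
  define k where "k y = f y - (f x + f' x * (y - x))" for y
  have kd: "(k has_real_derivative f' z - f' x) (at z)" if "p < z" "z < q" for z
    unfolding k_def using that by (auto intro!: derivative_eq_intros deriv)
  have kc: "continuous_on {a..b} k" if "p \<le> a" "b \<le> q" for a b
    unfolding k_def using that by (auto intro!: continuous_intros cont_sub)
  have "0 < k m" using above_tangent_left[of x m] \<open>x < m\<close> assms m by (simp add: k_def)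
  moreover have "k y \<le> 0" using below by (simp add: k_def)
  moreover have "0 \<le> k q" using assms by (simp add: k_def W_def algebra_simps)
  moreover obtain z1 where z1: "m < z1" "z1 < y" "k y - k m = (y - m) * (f' z1 - f' x)"
    using MVT_D[of m y k "\<lambda>z. f' z - f' x"] kd kc assms m by (metis less_le_not_le less_le_trans linorder_le_less_linear order_less_trans)
  moreover obtain z2 where z2: "y < z2" "z2 < q" "k q - k y = (q - y) * (f' z2 - f' x)"
    using MVT_D[of y q k "\<lambda>z. f' z - f' x"] kd kc assms m
    by (metis less_le_not_le less_le_trans linorder_le_less_linear order_less_trans)
  ultimately have "(y - m) * (f' z1 - f' x) < 0" "0 \<le> (q - y) * (f' z2 - f' x)"
    by linarith+
  then have "f' z1 < f' x" "f' x \<le> f' z2"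
    using assms by (auto simp: mult_less_0_iff zero_le_mult_iff)
  with deriv_dec[of z1 z2] z1 z2 m show False by auto
qed

lemma supported_of_W:
  assumes "p < x" "x < q" "W x \<le> 0"
  shows "supported {p..q} f x"
proof (rule supportedI[of _ _ _ "f' x"])
  fix y assume y: "y \<in> {p..q}"
  have "x < m" using W_pos[of x] assms by force
  consider "y = x" | "y \<noteq> x" "y \<le> m" | "m < y" "y < q" | "y = q"
    using y by fastforce
  then show "f x + f' x * (y - x) \<le> f y"
  proof cases
    case 4 then show ?thesis using assms by (simp add: W_def algebra_simps)
  qed (use above_tangent_left[of x y] above_tangent_right[of x y] y assms \<open>x < m\<close> in auto)
qed

text \<open>Let \<open>s x\<close> be the slope of the secant from \<open>x\<close> to the right
  end. Its derivative is -W x / (q - x)^2, so the secant from \<open>p\<close> has the largest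
  slope, which means that it stays below the graph.\<close>

lemma chord_of_W_pos:
  assumes W: "\<And>x. \<lbrakk>p < x; x < q\<rbrakk> \<Longrightarrow> 0 < W x"
  shows "chord_optimal p q f"
proof -
  define s where "s x = (f q - f x) / (q - x)" for x
  have s: "s x \<le> s p" if "p < x" "x < q" for x
  proof -
    have "s x < s p"
    proof (rule DERIV_neg_imp_decreasing_open[of p x s])
      fix y assume y: "p < y" "y < x"
      then have "y < q" using that by simp
      then have "(s has_real_derivative (- f' y * (q - y) - (f q - f y) * (- 1)) / (q - y)\<^sup>2) (at y)"
        unfolding s_def using y by (auto intro!: derivative_eq_intros deriv simp: power2_eq_square)
      moreover have "- f' y * (q - y) - (f q - f y) * (- 1) = - W y"
        by (simp add: W_def)
      ultimately show "\<exists>d. (s has_real_derivative d) (at y) \<and> d < 0"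
        using W[of y] y \<open>y < q\<close> by (intro exI conjI) (assumption, simp)
    next
      show "continuous_on {p..x} s"
        unfolding s_def using that by (auto intro!: continuous_intros cont_sub)
    qed (use that in auto)
    then show ?thesis by simp
  qed
  have "f q + s p * (x - q) \<le> f x" if "p \<le> x" "x \<le> q" for x
  proof (cases "p < x \<and> x < q")
    case True
    then have "(f q - f x) / (q - x) \<le> s p" using s[of x] by (simp add: s_def)
    with True show ?thesis by (simp add: divide_simps algebra_simps)
  next
    case False
    with that have "x = p \<or> x = q" by auto
    then show ?thesis using pq by (auto simp: s_def divide_simps) (simp add: algebra_simps)
  qed
  moreover have "f p = f q + s p * (p - q)" using pq by (simp add: s_def divide_simps) (simp add: algebra_simps)
  ultimately show ?thesis
    unfolding chord_optimal_def minorant_def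
    by (intro exI[of _ "f q - s p * q"] exI[of _ "s p"]) (auto simp: algebra_simps)
qed

text \<open>The tangent at \<open>t\<close> passes through the right end of the graph. To the left
  of \<open>t\<close> the function \<open>W\<close> is negative, so the tangents there are support
  lines. The chord ends at \<open>q\<close> because the concave side is on the right.\<close>

lemma tangent_of_W_zero:
  assumes t: "p < t" "t < q" "W t = 0"
  shows "tangent_optimal p q f"
proof -
  have "t < m" using W_pos[of t] t by force
  have fq: "f q = f t + f' t * (q - t)" using t by (simp add: W_def)
  have above: "f t + f' t * (x - t) < f x" if "x \<in> {p..q} - {t, q}" for x
    using above_tangent_left[of t x] above_tangent_right[of t x] that t \<open>t < m\<close>
    by (cases "x \<le> m") auto
  have supp: "supported {p..q} f x" if "p < x" "x \<le> t" for x
    using supported_of_W[of x] W_inc[of x t] that t \<open>t < m\<close> by (cases "x = t") auto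
  show ?thesis
    unfolding tangent_optimal_def
  proof (rule bexI[of _ t], rule bexI[of _ q], rule exI[of _ "f t - f' t * t"],
      rule exI[of _ "f' t"], intro conjI ballI)
    fix x assume "x \<in> {p..q} - {t, q}"
    with above[of x] show "f t - f' t * t + f' t * x < f x" by (simp add: algebra_simps)
  next
    fix x assume "x \<in> {p<..<q} - open_segment t q"
    then show "supported {p..q} f x"
      using supp t by (auto simp: open_segment_eq_real_ivl)
  qed (use fq t in \<open>auto simp: algebra_simps\<close>)
qed

theorem trichotomy:
  "(\<forall>x\<in>{p<..<q}. supported {p..q} f x) \<or> chord_optimal p q f \<or> tangent_optimal p q f"
proof (cases "\<forall>x. p < x \<and> x < q \<longrightarrow> 0 < W x")
  case True
  then show ?thesis using chord_of_W_pos by simp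
next
  case False
  then obtain x where x: "p < x" "x < q" "W x \<le> 0" by force
  show ?thesis
  proof (cases "\<forall>y. p < y \<and> y < q \<longrightarrow> W y \<le> 0")
    case True
    then show ?thesis using supported_of_W by simp
  next
    case False
    then obtain y where y: "p < y" "y < q" "0 < W y" by force
    have "x < m" using W_pos[of x] x by force
    \<comment> \<open>A reversed order would contradict the monotonicity of \<open>W\<close> on the
      convex side, where \<open>x\<close> must lie. The zero between \<open>x\<close> and
      \<open>y\<close> is the point of tangency.\<close>
    have "x < y"
    proof (rule ccontr)
      assume "\<not> x < y"
      with y x have "y < x" by (cases "y = x") auto
      then have "W y < W x" using W_inc[of y x] y x \<open>x < m\<close> by simp
      with x y show False by simp
    qed
    then obtain t where "x \<le> t" "t \<le> y" "W t = 0"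
      using IVT'[of W x 0 y] cont_W[of x y] x y by auto
    then show ?thesis using tangent_of_W_zero[of t] x y by auto
  qed
qed

end

section \<open>Entropy along a parabola\<close>

lemma curv_ratio_pos:
  assumes "0 < x" "x < 1"
  shows "0 < curv_ratio x"
proof -
  have "0 < 1 - x\<^sup>2" using assms by (simp add: abs_square_less_1)
  then show ?thesis
    using artanh_less[OF assms] assms by (simp add: curv_ratio_def field_simps)
qed

lemma bin_entropy_antimono:
  assumes "0 \<le> x" "x \<le> y" "y \<le> 1"
  shows "bin_entropy y \<le> bin_entropy x"
proof (cases "x = y")
  case False
  have "bin_entropy y < bin_entropy x"
  proof (rule DERIV_neg_imp_decreasing_open[of x y])
    fix z assume "x < z" "z < y"
    then have "0 < z" "z < 1" using assms by auto
    then show "\<exists>d. (bin_entropy has_real_derivative d) (at z) \<and> d < 0"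
      using DERIV_bin_entropy[of z] artanh_gt_self[of z]
      by (intro exI[of _ "- artanh z / ln 2"]) auto
  qed (use False assms in \<open>auto intro: continuous_on_subset[OF continuous_on_bin_entropy]\<close>)
  then show ?thesis by simp
qed simp

text \<open>The squared distance is the convenient variable because it is quadratic in the
  height.\<close>

definition sq_entropy :: "real \<Rightarrow> real" where
  "sq_entropy t = bin_entropy (sqrt t)"

lemma sq_entropy_antimono: "\<lbrakk>0 \<le> s; s \<le> t; t \<le> 1\<rbrakk> \<Longrightarrow> sq_entropy t \<le> sq_entropy s"
  unfolding sq_entropy_def by (rule bin_entropy_antimono) auto

lemma continuous_on_sq_entropy: "continuous_on {0..1} sq_entropy"
  unfolding sq_entropy_def
  by (rule continuous_on_compose2[OF continuous_on_bin_entropy]) (auto intro!: continuous_intros)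

text \<open>The derivative of \<open>sq_entropy\<close> up to the factor -1 / (2 ln 2). Division by
  zero gives it the value 0 at 0, although its limit there is 1; the derivative lemmas keep to 0 < t
  < 1.\<close>

definition sq_slope :: "real \<Rightarrow> real" where
  "sq_slope t = artanh (sqrt t) / sqrt t"

lemma DERIV_sq_entropy:
  assumes "0 < t" "t < 1"
  shows "(sq_entropy has_real_derivative - sq_slope t / (2 * ln 2)) (at t)"
proof -
  have "(sq_entropy has_real_derivative (- artanh (sqrt t) / ln 2) * (inverse (sqrt t) / 2)) (at t)"
    unfolding sq_entropy_def[abs_def] using assms
    by (intro DERIV_chain2[OF DERIV_bin_entropy] DERIV_real_sqrt) auto
  moreover have "(- a / ln 2) * (inverse b / 2) = - (a / b) / (2 * ln 2)" for a b :: real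
    by (simp add: field_simps)
  ultimately show ?thesis
    unfolding sq_slope_def by (simp only:)
qed

text \<open>This is the definition of \<open>curv_ratio\<close> solved for artanh. It lets the two
  terms of the second derivative along a parabola combine.\<close>

lemma sq_slope_eq:
  assumes "0 < t" "t < 1"
  shows "sq_slope t = (1 - t * curv_ratio (sqrt t)) / (1 - t)"
proof -
  define x where "x = sqrt t"
  have x: "0 < x" "t = x\<^sup>2" using assms by (auto simp: x_def)
  have "1 - x\<^sup>2 \<noteq> 0" using assms x by simp
  then show ?thesis
    using x(1) unfolding sq_slope_def curv_ratio_def x_def[symmetric] x(2)
    by (simp add: divide_simps) (simp add: algebra_simps eval_nat_numeral)
qed

lemma DERIV_sq_slope:
  assumes "0 < t" "t < 1"
  shows "(sq_slope has_real_derivative curv_ratio (sqrt t) / (2 * (1 - t))) (at t)"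
proof -
  define x where "x = sqrt t"
  have x: "0 < x" "x < 1" "t = x\<^sup>2" using assms by (auto simp: x_def)
  have x2: "1 - x\<^sup>2 \<noteq> 0" using assms x by simp
  have "((\<lambda>t. artanh (sqrt t)) has_real_derivative (1 / (1 - x\<^sup>2)) * (inverse x / 2)) (at t)"
    unfolding x_def using assms
    by (intro DERIV_chain2[OF artanh_real_has_field_derivative] DERIV_real_sqrt) auto
  moreover have "(sqrt has_real_derivative inverse x / 2) (at t)"
    unfolding x_def using assms by (intro DERIV_real_sqrt) auto
  ultimately have "(sq_slope has_real_derivative
      ((1 / (1 - x\<^sup>2)) * (inverse x / 2) * sqrt t - artanh (sqrt t) * (inverse x / 2)) / (sqrt t * sqrt t)) (at t)"
    unfolding sq_slope_def[abs_def] using assms by (intro DERIV_divide) auto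
  moreover have "((1 / (1 - x\<^sup>2)) * (inverse x / 2) * x - artanh x * (inverse x / 2)) / (x * x)
      = curv_ratio x / (2 * (1 - x\<^sup>2))"
    using x x2 unfolding curv_ratio_def
    by (simp add: divide_simps) (simp add: algebra_simps eval_nat_numeral)
  ultimately show ?thesis
    by (simp only: x_def[symmetric] x(3)[symmetric])
qed

lemma sq_slope_mono:
  assumes "0 < s" "s < t" "t < 1"
  shows "sq_slope s < sq_slope t"
proof (rule DERIV_pos_imp_increasing[OF \<open>s < t\<close>])
  fix x assume "s \<le> x" "x \<le> t"
  then have "0 < x" "x < 1" using assms by auto
  then show "\<exists>d. (sq_slope has_real_derivative d) (at x) \<and> 0 < d"
    using DERIV_sq_slope[of x] curv_ratio_pos[of "sqrt x"]
    by (intro exI[of _ "curv_ratio (sqrt x) / (2 * (1 - x))"]) auto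
qed

lemma sq_entropy_concave:
  assumes "0 \<le> s" "s \<le> 1" "0 \<le> t" "t \<le> 1" "0 \<le> l" "l \<le> 1"
  shows "(1 - l) * sq_entropy s + l * sq_entropy t \<le> sq_entropy ((1 - l) * s + l * t)"
proof -
  have *: "(1 - l) * sq_entropy s + l * sq_entropy t \<le> sq_entropy ((1 - l) * s + l * t)"
    if "0 \<le> s" "s < t" "t \<le> 1" "0 \<le> l" "l \<le> 1" for s t l
  proof -
    define z where "z = (1 - l) * s + l * t"
    have zs: "z - s = l * (t - s)" and tz: "t - z = (1 - l) * (t - s)"
      by (simp_all add: z_def algebra_simps)
    have "(t - z) * sq_entropy s + (z - s) * sq_entropy t \<le> (t - s) * sq_entropy z"
    proof (rule concave_above_chord)
      show "continuous_on {s..t} sq_entropy"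
        using that by (intro continuous_on_subset[OF continuous_on_sq_entropy]) auto
      show "(sq_entropy has_real_derivative - sq_slope x / (2 * ln 2)) (at x)" if "s < x" "x < t" for x
        using that \<open>0 \<le> s\<close> \<open>t \<le> 1\<close> by (intro DERIV_sq_entropy) auto
      show "- sq_slope y / (2 * ln 2) \<le> - sq_slope x / (2 * ln 2)" if "s < x" "x < y" "y < t" for x y
        using that \<open>0 \<le> s\<close> \<open>t \<le> 1\<close> sq_slope_mono[of x y] by (simp add: divide_right_mono)
      have "0 \<le> z - s" "0 \<le> t - z" unfolding zs tz using that by auto
      then show "s \<le> z" "z \<le> t" by auto
    qed
    then have "(t - s) * ((1 - l) * sq_entropy s + l * sq_entropy t) \<le> (t - s) * sq_entropy z"
      unfolding zs tz by (simp add: algebra_simps)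
    then show ?thesis using that by (simp add: z_def)
  qed
  consider "s < t" | "s = t" | "t < s" by linarith
  then show ?thesis
  proof cases
    case 2 then show ?thesis by (simp add: algebra_simps)
  next
    \<comment> \<open>Exchanging the two points exchanges the weights \<open>l\<close> and
      \<open>1 - l\<close>.\<close>
    case 3 then show ?thesis using *[of t s "1 - l"] assms by (simp add: algebra_simps)
  qed (use * assms in auto)
qed

text \<open>A downward parabola with apex \<open>(w, M)\<close> and leading coefficient \<open>- \<kappa>\<close> for the squared
  distance from the origin.\<close>

definition arc_entropy :: "real \<Rightarrow> real \<Rightarrow> real \<Rightarrow> real \<Rightarrow> real" where
  "arc_entropy M \<kappa> w z = sq_entropy (M - \<kappa> * (z - w)\<^sup>2)"

lemma continuous_on_arc_entropy:
  assumes "\<And>z. z \<in> S \<Longrightarrow> 0 \<le> M - \<kappa> * (z - w)\<^sup>2 \<and> M - \<kappa> * (z - w)\<^sup>2 \<le> 1"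
  shows "continuous_on S (arc_entropy M \<kappa> w)"
  unfolding arc_entropy_def
  by (rule continuous_on_compose2[OF continuous_on_sq_entropy])
    (use assms in \<open>auto intro!: continuous_intros\<close>)

context
  fixes M \<kappa> w z t :: real
  assumes t: "t = M - \<kappa> * (z - w)\<^sup>2" "0 < t" "t < 1"
begin

lemma deriv_quad: "((\<lambda>z. M - \<kappa> * (z - w)\<^sup>2) has_real_derivative - 2 * \<kappa> * (z - w)) (at z)"
  by (auto intro!: derivative_eq_intros)

lemma DERIV_arc_entropy:
  "(arc_entropy M \<kappa> w has_real_derivative
     \<kappa> / ln 2 * ((z - w) * sq_slope (M - \<kappa> * (z - w)\<^sup>2))) (at z)"
proof -
  have "(arc_entropy M \<kappa> w has_real_derivative
      (- sq_slope (M - \<kappa> * (z - w)\<^sup>2) / (2 * ln 2)) * (- 2 * \<kappa> * (z - w))) (at z)"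
    unfolding arc_entropy_def[abs_def]
    using t by (intro DERIV_chain2[OF DERIV_sq_entropy deriv_quad]) auto
  moreover have "(- s / (2 * ln 2)) * (- 2 * \<kappa> * d) = \<kappa> / ln 2 * (d * s)" for s d
    by (simp add: mult_ac)
  ultimately show ?thesis by (simp only:)
qed

text \<open>With d = z - w, the product rule gives terms with t * psi and \<kappa> * d^2 * psi,
  where psi is \<open>curv_ratio\<close> at the distance. Since t + \<kappa> * d^2 = M, they merge
  into M * psi.\<close>

lemma DERIV_arc_entropy_slope:
  "((\<lambda>z. \<kappa> / ln 2 * ((z - w) * sq_slope (M - \<kappa> * (z - w)\<^sup>2))) has_real_derivative
     \<kappa> / (ln 2 * (1 - t)) * (1 - M * curv_ratio (sqrt t))) (at z)"
proof -
  have "((\<lambda>z. sq_slope (M - \<kappa> * (z - w)\<^sup>2)) has_real_derivative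
      curv_ratio (sqrt t) / (2 * (1 - t)) * (- 2 * \<kappa> * (z - w))) (at z)"
    unfolding t(1) using t by (intro DERIV_chain2[OF DERIV_sq_slope deriv_quad]) auto
  moreover have "((\<lambda>z. z - w) has_real_derivative 1) (at z)"
    by (auto intro!: derivative_eq_intros)
  ultimately have "((\<lambda>z. \<kappa> / ln 2 * ((z - w) * sq_slope (M - \<kappa> * (z - w)\<^sup>2))) has_real_derivative
      \<kappa> / ln 2 * (1 * sq_slope t + curv_ratio (sqrt t) / (2 * (1 - t)) * (- 2 * \<kappa> * (z - w)) * (z - w))) (at z)"
    unfolding t(1) by (intro DERIV_cmult DERIV_mult)
  moreover have "1 * sq_slope t + curv_ratio (sqrt t) / (2 * (1 - t)) * (- 2 * \<kappa> * (z - w)) * (z - w)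
      = (1 - M * curv_ratio (sqrt t)) / (1 - t)"
  proof -
    define d where "d = z - w"
    have M: "M = t + \<kappa> * d * d" using t(1) by (simp add: power2_eq_square d_def)
    show ?thesis
      unfolding d_def[symmetric] M sq_slope_eq[OF t(2,3)]
      using t(2,3) by (simp add: divide_simps) (simp add: algebra_simps)
  qed
  ultimately show ?thesis by (simp add: mult_ac)
qed

end

text \<open>A concave parabola exceeds its chord by \<kappa> (q - z) (z - p). Strict positivity
  inside the interval keeps the argument away from t = 0, where the square root is not
  differentiable.\<close>

lemma quad_pos:
  fixes M \<kappa> w :: real
  assumes "0 < \<kappa>" "0 \<le> M - \<kappa> * (p - w)\<^sup>2" "0 \<le> M - \<kappa> * (q - w)\<^sup>2" "p < z" "z < q"
  shows "0 < M - \<kappa> * (z - w)\<^sup>2"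
proof -
  have "(q - p) * (M - \<kappa> * (z - w)\<^sup>2) =
      (q - z) * (M - \<kappa> * (p - w)\<^sup>2) + (z - p) * (M - \<kappa> * (q - w)\<^sup>2)
      + \<kappa> * ((q - p) * ((q - z) * (z - p)))"
    by (simp add: algebra_simps power2_eq_square)
  also have "\<dots> > 0"
    using assms by (intro add_nonneg_pos add_nonneg_nonneg mult_nonneg_nonneg mult_pos_pos) auto
  finally show ?thesis using assms by (simp add: zero_less_mult_iff)
qed

section \<open>Convexity and inflection of the entropy along the parabola\<close>

lemma convex_on_LIMSEQ:
  fixes f :: "'a::real_vector \<Rightarrow> real"
  assumes "\<And>n. convex_on S (g n)" "\<And>x. x \<in> S \<Longrightarrow> (\<lambda>n. g n x) \<longlonglongrightarrow> f x"
  shows "convex_on S f"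
proof (rule convex_onI)
  show S: "convex S" using assms(1)[of 0] convex_on_imp_convex by blast
  fix t x y assume t: "0 < t" "t < (1::real)" and xy: "x \<in> S" "y \<in> S"
  then have "(1 - t) *\<^sub>R x + t *\<^sub>R y \<in> S"
    using S convexD[of S x y "1 - t" t] by auto
  then show "f ((1 - t) *\<^sub>R x + t *\<^sub>R y) \<le> (1 - t) * f x + t * f y"
    using t xy by (intro LIMSEQ_le[OF assms(2) tendsto_add[OF tendsto_mult_left tendsto_mult_left]])
      (auto intro!: assms(2) exI[of _ 0] convex_onD[OF assms(1)])
qed

text \<open>Shrinking the parabola by a factor below 1 keeps it away from the singularity of the
  entropy at pure states.\<close>

lemma convex_on_arc_entropy:
  assumes \<kappa>: "0 < \<kappa>" and M: "M \<le> 1" and nonneg: "0 \<le> M - \<kappa> * (p - w)\<^sup>2" "0 \<le> M - \<kappa> * (q - w)\<^sup>2"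
  shows "convex_on {p<..<q} (arc_entropy M \<kappa> w)"
proof -
  \<comment> \<open>The double \<open>Suc\<close> starts the sequence at 1/2; with a single one the
    factor would be 0 at n = 0 and the parabola would degenerate.\<close>
  define r :: "nat \<Rightarrow> real" where "r n = 1 - inverse (real (Suc (Suc n)))" for n
  have r: "0 < r n" "r n < 1" for n
    by (auto simp: r_def divide_simps)
  have le1: "M - \<kappa> * (z - w)\<^sup>2 \<le> 1" for z
  proof -
    have "0 \<le> \<kappa> * (z - w)\<^sup>2" using \<kappa> by simp
    then show ?thesis using M by linarith
  qed
  have convex: "convex_on {p<..<q} (arc_entropy (r n * M) (r n * \<kappa>) w)" for n
  proof (rule f''_ge0_imp_convex)
    fix z assume z: "z \<in> {p<..<q}"
    define t where "t = r n * M - r n * \<kappa> * (z - w)\<^sup>2"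
    have eq: "t = r n * (M - \<kappa> * (z - w)\<^sup>2)" by (simp add: t_def algebra_simps)
    have pos: "0 < M - \<kappa> * (z - w)\<^sup>2" using quad_pos[OF \<kappa> nonneg] z by simp
    have "r n * (M - \<kappa> * (z - w)\<^sup>2) \<le> r n"
      using r[of n] le1[of z] mult_left_le[of _ "r n"] by simp
    then have t: "0 < t" "t < 1"
      unfolding eq using r[of n] mult_pos_pos[OF _ pos, of "r n"] by linarith+
    note * = t_def t
    show "(arc_entropy (r n * M) (r n * \<kappa>) w has_real_derivative
        r n * \<kappa> / ln 2 * ((z - w) * sq_slope (r n * M - r n * \<kappa> * (z - w)\<^sup>2))) (at z)"
      by (rule DERIV_arc_entropy[OF *])
    show "((\<lambda>z. r n * \<kappa> / ln 2 * ((z - w) * sq_slope (r n * M - r n * \<kappa> * (z - w)\<^sup>2)))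
        has_real_derivative r n * \<kappa> / (ln 2 * (1 - (r n * M - r n * \<kappa> * (z - w)\<^sup>2))) *
          (1 - r n * M * curv_ratio (sqrt (r n * M - r n * \<kappa> * (z - w)\<^sup>2)))) (at z)"
      using DERIV_arc_entropy_slope[OF *] by (simp only: t_def)
    have c: "0 < curv_ratio (sqrt t)" "curv_ratio (sqrt t) < 1"
      using t curv_ratio_pos curv_ratio_less_1 by auto
    have "r n * M \<le> 1" using r[of n] M mult_left_le[of M "r n"] by linarith
    then have "r n * M * curv_ratio (sqrt t) \<le> 1 * curv_ratio (sqrt t)"
      using c r[of n] by (intro mult_right_mono) auto
    with c have "r n * M * curv_ratio (sqrt t) \<le> 1" by linarith
    then show "0 \<le> r n * \<kappa> / (ln 2 * (1 - (r n * M - r n * \<kappa> * (z - w)\<^sup>2))) *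
          (1 - r n * M * curv_ratio (sqrt (r n * M - r n * \<kappa> * (z - w)\<^sup>2)))"
      unfolding t_def[symmetric] using r[of n] \<kappa> t(2)
      by (intro mult_nonneg_nonneg divide_nonneg_nonneg) auto
  qed simp
  have "r \<longlonglongrightarrow> 1 - 0"
    unfolding r_def by (intro tendsto_intros LIMSEQ_Suc[OF LIMSEQ_inverse_real_of_nat])
  then have lim: "r \<longlonglongrightarrow> 1" by simp
  have "(\<lambda>n. arc_entropy (r n * M) (r n * \<kappa>) w z) \<longlonglongrightarrow> arc_entropy M \<kappa> w z"
    if z: "z \<in> {p<..<q}" for z
  proof -
    define s where "s = M - \<kappa> * (z - w)\<^sup>2"
    have s: "0 \<le> s" "s \<le> 1" using le1[of z] quad_pos[OF \<kappa> nonneg] z by (auto simp: s_def less_imp_le)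
    have "(\<lambda>n. sq_entropy (r n * s)) \<longlonglongrightarrow> sq_entropy s"
    proof (rule continuous_on_tendsto_compose[OF continuous_on_sq_entropy])
      show "(\<lambda>n. r n * s) \<longlonglongrightarrow> s" using tendsto_mult_right[OF lim, of s] by simp
      show "\<forall>\<^sub>F n in sequentially. r n * s \<in> {0..1}"
        using r s by (intro always_eventually) (auto simp: less_imp_le mult_le_one)
    qed (use s in auto)
    moreover have "arc_entropy (r n * M) (r n * \<kappa>) w z = sq_entropy (r n * s)" for n
      by (simp add: arc_entropy_def s_def right_diff_distrib mult.assoc)
    ultimately show ?thesis
      by (simp add: arc_entropy_def s_def)
  qed
  then show ?thesis by (rule convex_on_LIMSEQ[OF convex])
qed

text \<open>With the apex to the right of the interval, the squared distance \<open>Q\<close>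
  increases with the height, and so does \<open>R\<close>. Thus 1 - R changes sign at most once,
  from positive to negative, as \<open>convex_concave\<close> demands.\<close>

lemma arc_entropy_right_trichotomy:
  assumes pq: "p < q" "q < w" and \<kappa>: "0 < \<kappa>"
    and bounds: "\<And>z. z \<in> {p..q} \<Longrightarrow> 0 \<le> M - \<kappa> * (z - w)\<^sup>2 \<and> M - \<kappa> * (z - w)\<^sup>2 \<le> 1"
  defines "f \<equiv> arc_entropy M \<kappa> w"
  shows "(\<forall>x\<in>{p<..<q}. supported {p..q} f x) \<or> chord_optimal p q f \<or> tangent_optimal p q f"
proof -
  define Q where "Q z = M - \<kappa> * (z - w)\<^sup>2" for z
  define R where "R z = M * curv_ratio (sqrt (Q z))" for z
  have Q_mono: "Q x < Q y" if "x < y" "y \<le> q" for x y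
  proof -
    have "(y - w)\<^sup>2 < (x - w)\<^sup>2"
      using that pq power_strict_mono[of "w - y" "w - x" 2] by (simp add: power2_commute)
    then show ?thesis using \<kappa> by (simp add: Q_def)
  qed
  have Q: "0 < Q z" "Q z < 1" if "p < z" "z < q" for z
    using Q_mono[of p z] Q_mono[of z q] bounds[of p] bounds[of q] that pq by (auto simp: Q_def)
  \<comment> \<open>Positivity of \<open>M\<close> lets \<open>R\<close> inherit strict monotonicity
    from \<open>curv_ratio\<close>.\<close>
  have "0 < Q q" using Q_mono[of p q] bounds[of p] pq by (auto simp: Q_def)
  moreover have "Q q \<le> M" using \<kappa> by (simp add: Q_def)
  ultimately have "0 < M" by simp
  then have R_mono: "R x < R y" if "p < x" "x < y" "y < q" for x y
    unfolding R_def using that Q[of x] Q[of y] Q_mono[of x y]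
    by (intro mult_strict_left_mono curv_ratio_strict_mono) auto
  \<comment> \<open>The inflection is taken as a supremum because R z = 1 may have no solution.
    Inserting \<open>p\<close> keeps the set nonempty when the function is concave throughout; then
    \<open>m = p\<close>.\<close>
  define S where "S = insert p {z. p < z \<and> z < q \<and> R z \<le> 1}"
  define m where "m = Sup S"
  have S: "S \<noteq> {}" "bdd_above S" "\<And>z. z \<in> S \<Longrightarrow> p \<le> z \<and> z \<le> q"
    using pq by (auto simp: S_def intro!: bdd_aboveI[of _ q])
  interpret convex_concave p q m f "\<lambda>z. \<kappa> / ln 2 * ((z - w) * sq_slope (M - \<kappa> * (z - w)\<^sup>2))"
    "\<lambda>z. \<kappa> / (ln 2 * (1 - Q z)) * (1 - R z)"
  proof
    show "p \<le> m" unfolding m_def using S by (intro cSup_upper) (auto simp: S_def)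
    show "m \<le> q" unfolding m_def using S by (intro cSup_least) auto
    show "continuous_on {p..q} f" unfolding f_def by (rule continuous_on_arc_entropy) (rule bounds)
    fix z
    { assume z: "p < z" "z < q"
      show "(f has_real_derivative \<kappa> / ln 2 * ((z - w) * sq_slope (M - \<kappa> * (z - w)\<^sup>2))) (at z)"
        unfolding f_def by (rule DERIV_arc_entropy[OF Q_def Q[OF z]])
      show "((\<lambda>z. \<kappa> / ln 2 * ((z - w) * sq_slope (M - \<kappa> * (z - w)\<^sup>2))) has_real_derivative
          \<kappa> / (ln 2 * (1 - Q z)) * (1 - R z)) (at z)"
        unfolding R_def by (rule DERIV_arc_entropy_slope[OF Q_def Q[OF z]]) }
    { assume z: "p < z" "z < m"
      then obtain y where y: "y \<in> S" "z < y" using less_cSupD[OF S(1)] by (auto simp: m_def)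
      then have "R z < 1" "z < q" using R_mono[of z y] z by (auto simp: S_def)
      then show "0 < \<kappa> / (ln 2 * (1 - Q z)) * (1 - R z)" using Q[of z] z \<kappa> by simp }
    { assume z: "m < z" "z < q"
      have "p \<le> m" unfolding m_def using S by (intro cSup_upper) (auto simp: S_def)
      have "z \<notin> S" using cSup_upper[of z S] S z by (auto simp: m_def)
      then have "1 < R z" using z \<open>p \<le> m\<close> by (auto simp: S_def)
      then show "\<kappa> / (ln 2 * (1 - Q z)) * (1 - R z) < 0"
        using Q[of z] z \<kappa> \<open>p \<le> m\<close> by (intro mult_pos_neg) auto }
  qed (use pq in auto)
  show ?thesis by (rule trichotomy)
qed

section \<open>Reflection of the height axis\<close>

lemma minorant_reflect: "minorant {- q..- p} (\<lambda>x. f (- x)) c d \<longleftrightarrow> minorant {p..q} f c (- d)"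
  for p q :: real
  unfolding minorant_def by (metis (no_types, opaque_lifting) atLeastAtMost_iff minus_minus mult_minus_left mult_minus_right neg_le_iff_le)

lemma supported_reflect:
  fixes p q :: real
  assumes "supported {- q..- p} (\<lambda>x. f (- x)) (- x)"
  shows "supported {p..q} f x"
proof -
  obtain c d where "minorant {- q..- p} (\<lambda>x. f (- x)) c d" "f x = c + d * (- x)"
    using assms by (auto simp: supported_def)
  then show ?thesis
    unfolding minorant_reflect supported_def by (intro exI[of _ c] exI[of _ "- d"]) auto
qed

lemma chord_optimal_reflect:
  assumes "chord_optimal (- q) (- p) (\<lambda>x. f (- x))"
  shows "chord_optimal p q f"
proof -
  obtain c d where "minorant {- q..- p} (\<lambda>x. f (- x)) c d" "f q = c + d * (- q)" "f p = c + d * (- p)"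
    using assms by (auto simp: chord_optimal_def)
  then show ?thesis
    unfolding minorant_reflect chord_optimal_def by (intro exI[of _ c] exI[of _ "- d"]) auto
qed

text \<open>The definition leaves open which end point \<open>e\<close> is and uses the unoriented
  \<open>open_segment\<close>; this makes it symmetric under reflection, which exchanges the upper
  and the lower triangle.\<close>

lemma tangent_optimal_reflect:
  assumes "tangent_optimal (- q) (- p) (\<lambda>x. f (- x))"
  shows "tangent_optimal p q f"
proof -
  obtain t e c d where t: "t \<in> {- q<..<- p}" "e \<in> {- q, - p}" "f (- t) = c + d * t" "f (- e) = c + d * e"
    and above: "\<And>x. x \<in> {- q..- p} - {t, e} \<Longrightarrow> c + d * x < f (- x)"
    and supp: "\<And>x. x \<in> {- q<..<- p} - open_segment t e \<Longrightarrow> supported {- q..- p} (\<lambda>x. f (- x)) x"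
    using assms unfolding tangent_optimal_def by blast
  show ?thesis
    unfolding tangent_optimal_def
  proof (rule bexI[of _ "- t"], rule bexI[of _ "- e"], rule exI[of _ c], rule exI[of _ "- d"],
      intro conjI ballI)
    fix x assume "x \<in> {p..q} - {- t, - e}"
    then show "c + - d * x < f x" using above[of "- x"] by force
  next
    fix x assume "x \<in> {p<..<q} - open_segment (- t) (- e)"
    then have "- x \<in> {- q<..<- p} - open_segment t e"
      by (auto simp: open_segment_eq_real_ivl split: if_splits)
    then show "supported {p..q} f x" by (rule supported_reflect[OF supp])
  qed (use t in auto)
qed

lemma arc_entropy_trichotomy:
  assumes pq: "p < q" and \<kappa>: "0 < \<kappa>"
    and bounds: "\<And>z. z \<in> {p..q} \<Longrightarrow> 0 \<le> M - \<kappa> * (z - w)\<^sup>2 \<and> M - \<kappa> * (z - w)\<^sup>2 \<le> 1"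
  defines "f \<equiv> arc_entropy M \<kappa> w"
  shows "(\<forall>x\<in>{p<..<q}. supported {p..q} f x) \<or> chord_optimal p q f \<or> tangent_optimal p q f"
proof (cases "M \<le> 1")
  case True
  then have "convex_on {p<..<q} f"
    unfolding f_def using bounds[of p] bounds[of q] pq by (intro convex_on_arc_entropy[OF \<kappa>]) auto
  moreover have "continuous_on {p..q} f"
    unfolding f_def by (rule continuous_on_arc_entropy) (rule bounds)
  ultimately show ?thesis using supported_of_convex_on by auto
next
  case False
  then have "w \<notin> {p..q}" using bounds[of w] by auto
  then consider "q < w" | "w < p" by force
  then show ?thesis
  proof cases
    case 1
    then show ?thesis unfolding f_def using arc_entropy_right_trichotomy[OF pq _ \<kappa> bounds] by blast
  next
    case 2
    have sq: "(x - - w)\<^sup>2 = (- x - w)\<^sup>2" for x :: real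
      by (simp add: power2_eq_square algebra_simps)
    \<comment> \<open>Reflection moves the apex to -w, to the right of the reflected
      interval.\<close>
    have eq: "arc_entropy M \<kappa> (- w) = (\<lambda>x. f (- x))"
      unfolding f_def arc_entropy_def sq ..
    have "(\<forall>x\<in>{- q<..<- p}. supported {- q..- p} (\<lambda>x. f (- x)) x) \<or>
        chord_optimal (- q) (- p) (\<lambda>x. f (- x)) \<or> tangent_optimal (- q) (- p) (\<lambda>x. f (- x))"
      unfolding eq[symmetric]
    proof (rule arc_entropy_right_trichotomy)
      fix z assume "z \<in> {- q..- p}"
      then show "0 \<le> M - \<kappa> * (z - - w)\<^sup>2 \<and> M - \<kappa> * (z - - w)\<^sup>2 \<le> 1"
        unfolding sq by (intro bounds) auto
    qed (use pq 2 \<kappa> in auto)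
    moreover have "supported {p..q} f x"
      if "\<forall>x\<in>{- q<..<- p}. supported {- q..- p} (\<lambda>x. f (- x)) x" "x \<in> {p<..<q}" for x
      by (rule supported_reflect) (use that in auto)
    ultimately show ?thesis using chord_optimal_reflect tangent_optimal_reflect by blast
  qed
qed

section \<open>Geometry of the steering ellipsoid\<close>

lemma norm_AB_pos: "x_state \<rho> \<Longrightarrow> 0 < norm_AB \<rho>"
  by (auto simp: x_state_def norm_AB_def)

lemma ell1_nonneg: "x_state \<rho> \<Longrightarrow> 0 \<le> ell1 \<rho>"
  by (auto simp: x_state_def ell1_def norm_AB_def intro!: divide_nonneg_nonneg)

lemma ell2_nonneg: "x_state \<rho> \<Longrightarrow> 0 \<le> ell2 \<rho>"
  using norm_AB_pos[of \<rho>] by (simp add: ell2_def)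

lemma ell2_le_ell1: "x_state \<rho> \<Longrightarrow> ell2 \<rho> \<le> ell1 \<rho>"
  by (auto simp: x_state_def ell1_def ell2_def norm_AB_def intro!: divide_right_mono)

lemma ell3_nonneg: "x_state \<rho> \<Longrightarrow> 0 \<le> ell3 \<rho>"
  using norm_AB_pos[of \<rho>] by (simp add: ell3_def)

text \<open>Here \<open>r\<close> and \<open>s\<close> are the heights of the states to which \<open>B\<close> is steered when \<open>A\<close> is
  measured in the computational basis, and \<open>l\<close> is the probability of the first outcome.\<close>

lemma x_state_steering:
  assumes "x_state \<rho>"
  obtains l r s where "0 < l" "l < 1" "\<bar>r\<bar> \<le> 1" "\<bar>s\<bar> \<le> 1"
    "z_0 \<rho> = (r + s) / 2" "ell3 \<rho> = \<bar>r - s\<bar> / 2" "z_B \<rho> = l * r + (1 - l) * s"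
    "(ell1 \<rho>)\<^sup>2 \<le> (1 - r * s + sqrt ((1 - r\<^sup>2) * (1 - s\<^sup>2))) / 2"
proof -
  obtain a b c d u v where nonneg: "0 \<le> a" "0 \<le> b" "0 \<le> c" "0 \<le> d" "0 \<le> u" "0 \<le> v"
    and sum: "a + b + c + d = 1" and uv: "u\<^sup>2 \<le> a * d" "v\<^sup>2 \<le> b * c"
    and pos: "(a + b) * (c + d) > 0" and \<rho>: "\<rho> = x_matrix a b c d u v"
    using assms by (auto simp: x_state_def)
  define l m where "l = a + b" and "m = c + d"
  have l: "0 < l" "0 < m" and lm: "m = 1 - l"
    using pos nonneg sum by (auto simp: l_def m_def zero_less_mult_iff)
  define r s where "r = (a - b) / l" and "s = (c - d) / m"
  have abcd: "a = l * (1 + r) / 2" "b = l * (1 - r) / 2" "c = m * (1 + s) / 2" "d = m * (1 - s) / 2"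
  proof -
    have "l * r = a - b" "m * s = c - d" using l by (simp_all add: r_def s_def)
    then show "a = l * (1 + r) / 2" "b = l * (1 - r) / 2" "c = m * (1 + s) / 2" "d = m * (1 - s) / 2"
      by (simp_all add: distrib_left right_diff_distrib) (simp_all add: l_def m_def)
  qed
  have rs: "\<bar>r\<bar> \<le> 1" "\<bar>s\<bar> \<le> 1"
    using l nonneg unfolding r_def s_def by (auto simp: abs_le_iff l_def m_def divide_simps)
  have N: "norm_AB \<rho> = l * m" by (simp add: norm_AB_def \<rho> l_def m_def)
  have E: "a * c - b * d = (l * m) * ((r + s) / 2)" "a * d - b * c = (l * m) * ((r - s) / 2)"
    unfolding abcd by (simp_all add: field_simps)
  have z0: "z_0 \<rho> = (r + s) / 2"
    unfolding z_0_def N unfolding \<rho> ent_x_matrix E using l by simp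
  have e3: "ell3 \<rho> = \<bar>r - s\<bar> / 2"
    unfolding ell3_def N unfolding \<rho> ent_x_matrix E using l by (simp add: abs_mult)
  have zB: "z_B \<rho> = l * r + (1 - l) * s"
    unfolding z_B_def lm[symmetric] using l by (simp add: \<rho> r_def s_def)
  \<comment> \<open>In (u + v)^2 the squares are bounded by ad + bc. The cross term is bounded
    through (uv)^2 <= (ad)(bc), and regrouping this product as (ab)(cd) yields the factors 1 - r^2
    and 1 - s^2.\<close>
  define w where "w = sqrt ((1 - r\<^sup>2) * (1 - s\<^sup>2))"
  have "(u * v)\<^sup>2 \<le> (a * d) * (b * c)"
    unfolding power_mult_distrib using uv nonneg by (intro mult_mono) auto
  also have "\<dots> = (l * m / 4)\<^sup>2 * ((1 - r\<^sup>2) * (1 - s\<^sup>2))"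
    unfolding abcd by (simp add: field_simps power2_eq_square)
  finally have "u * v \<le> sqrt ((l * m / 4)\<^sup>2 * ((1 - r\<^sup>2) * (1 - s\<^sup>2)))"
    by (rule real_le_rsqrt)
  then have "u * v \<le> l * m / 4 * w" using l by (simp add: real_sqrt_mult w_def)
  moreover have "a * d + b * c = l * m * (1 - r * s) / 2"
    unfolding abcd by (simp add: field_simps)
  ultimately have "(u + v)\<^sup>2 \<le> l * m * ((1 - r * s + w) / 2)"
    using uv by (simp add: power2_sum field_simps)
  then have "(ell1 \<rho>)\<^sup>2 \<le> (1 - r * s + w) / 2"
    unfolding ell1_def N using l by (simp add: \<rho> power_divide divide_le_eq mult.commute)
  then show thesis
    using that[of l r s] l lm rs z0 e3 zB by (simp add: w_def)
qed

text \<open>The vertices are at the heights min r s and max r s, and \<open>z_B\<close> averages r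
  and s with weights strictly between 0 and 1.\<close>

lemma x_state_z_B:
  assumes "x_state \<rho>"
  shows "z_H \<rho> \<le> z_B \<rho>" "z_B \<rho> \<le> z_G \<rho>"
    and "0 < ell3 \<rho> \<Longrightarrow> z_H \<rho> < z_B \<rho>" "0 < ell3 \<rho> \<Longrightarrow> z_B \<rho> < z_G \<rho>"
proof -
  obtain l r s where l: "0 < l" "l < 1"
    and eqs: "z_0 \<rho> = (r + s) / 2" "ell3 \<rho> = \<bar>r - s\<bar> / 2" "z_B \<rho> = l * r + (1 - l) * s"
    using x_state_steering[OF assms] by metis
  have b: "z_B \<rho> = s + l * (r - s)" "z_B \<rho> = r + (1 - l) * (s - r)"
    by (simp_all add: eqs(3) algebra_simps)
  consider "r < s" | "r = s" | "s < r" by linarith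
  then have "z_H \<rho> \<le> z_B \<rho> \<and> z_B \<rho> \<le> z_G \<rho> \<and> (0 < ell3 \<rho> \<longrightarrow> z_H \<rho> < z_B \<rho> \<and> z_B \<rho> < z_G \<rho>)"
  proof cases
    case 1
    then have "z_H \<rho> = r" "z_G \<rho> = s" by (simp_all add: z_H_def z_G_def eqs field_simps)
    moreover have "0 < (1 - l) * (s - r)" "0 < l * (s - r)" using 1 l by simp_all
    ultimately show ?thesis using b by (simp add: algebra_simps)
  next
    case 2
    then show ?thesis by (simp add: z_H_def z_G_def eqs algebra_simps)
  next
    case 3
    then have "z_H \<rho> = s" "z_G \<rho> = r" by (simp_all add: z_H_def z_G_def eqs field_simps)
    moreover have "0 < (1 - l) * (r - s)" "0 < l * (r - s)" using 3 l by simp_all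
    ultimately show ?thesis using b by (simp add: algebra_simps)
  qed
  then show "z_H \<rho> \<le> z_B \<rho>" "z_B \<rho> \<le> z_G \<rho>"
    "0 < ell3 \<rho> \<Longrightarrow> z_H \<rho> < z_B \<rho>" "0 < ell3 \<rho> \<Longrightarrow> z_B \<rho> < z_G \<rho>" by auto
qed

section \<open>Distance from the origin at a given height\<close>

lemma height_param:
  assumes "x_state \<rho>" "z \<in> {z_H \<rho>..z_G \<rho>}"
  shows "((z - z_0 \<rho>) / ell3 \<rho>)\<^sup>2 \<le> 1" "z = z_0 \<rho> + ell3 \<rho> * ((z - z_0 \<rho>) / ell3 \<rho>)"
proof -
  have "\<bar>(z - z_0 \<rho>) / ell3 \<rho>\<bar> \<le> 1"
    using assms ell3_nonneg[of \<rho>] by (cases "ell3 \<rho> = 0") (auto simp: z_H_def z_G_def divide_le_eq abs_le_iff)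
  then show "((z - z_0 \<rho>) / ell3 \<rho>)\<^sup>2 \<le> 1" by (simp add: abs_square_le_1)
  show "z = z_0 \<rho> + ell3 \<rho> * ((z - z_0 \<rho>) / ell3 \<rho>)"
    using assms by (cases "ell3 \<rho> = 0") (auto simp: z_H_def z_G_def)
qed

lemma norm_vector3: "norm (vector [x, y, z] :: real^3) = sqrt (x\<^sup>2 + y\<^sup>2 + z\<^sup>2)"
  by (simp add: norm_vec_def L2_set_def sum_3)

text \<open>The squared distance of the ellipse points at height \<open>z\<close>. If
  \<open>ell3\<close> is 0, the quotient is 0 and the value is that of the horizontal
  vertices.\<close>

definition radius_sq :: "complex^4^4 \<Rightarrow> real \<Rightarrow> real" where
  "radius_sq \<rho> z = (ell1 \<rho>)\<^sup>2 * (1 - ((z - z_0 \<rho>) / ell3 \<rho>)\<^sup>2) + z\<^sup>2"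

lemma norm_at_height:
  assumes "x_state \<rho>" "z \<in> {z_H \<rho>..z_G \<rho>}"
  shows "norm (right_point \<rho> z) = sqrt (radius_sq \<rho> z)" "norm (left_point \<rho> z) = sqrt (radius_sq \<rho> z)"
  using height_param[OF assms]
  by (auto simp: right_point_def left_point_def norm_vector3 radius_sq_def half_width_def power_mult_distrib)

lemma radius_sq_nonneg:
  assumes "x_state \<rho>" "z \<in> {z_H \<rho>..z_G \<rho>}"
  shows "0 \<le> radius_sq \<rho> z"
  using height_param[OF assms] by (auto simp: radius_sq_def)

lemma weighted_amgm:
  fixes x y \<alpha> \<beta> :: real
  assumes "0 \<le> x" "0 \<le> y"
  shows "2 * \<alpha> * \<beta> * sqrt (x * y) \<le> \<alpha>\<^sup>2 * x + \<beta>\<^sup>2 * y"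
proof -
  have "0 \<le> (\<alpha> * sqrt x - \<beta> * sqrt y)\<^sup>2" by simp
  also have "\<dots> = \<alpha>\<^sup>2 * x + \<beta>\<^sup>2 * y - 2 * \<alpha> * \<beta> * sqrt (x * y)"
    using assms by (simp add: power2_diff power_mult_distrib real_sqrt_mult)
  finally show ?thesis by simp
qed

text \<open>Write z = \<alpha> r + \<beta> s with \<alpha> + \<beta> = 1; the factor of
  \<open>ell1\<close> squared is then 4 \<alpha> \<beta>. After the positivity bound on
  \<open>ell1\<close>, the weighted mean inequality for 1 - r^2 and 1 - s^2 removes r and s, leaving
  (\<alpha> + \<beta>)^2 = 1.\<close>

lemma radius_sq_le_1:
  assumes "x_state \<rho>" "z \<in> {z_H \<rho>..z_G \<rho>}"
  shows "radius_sq \<rho> z \<le> 1"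
proof -
  obtain l r s where rs: "\<bar>r\<bar> \<le> 1" "\<bar>s\<bar> \<le> 1"
    and eqs: "z_0 \<rho> = (r + s) / 2" "ell3 \<rho> = \<bar>r - s\<bar> / 2"
    and ell: "(ell1 \<rho>)\<^sup>2 \<le> (1 - r * s + sqrt ((1 - r\<^sup>2) * (1 - s\<^sup>2))) / 2"
    using x_state_steering[OF assms(1)] by metis
  have rs2: "0 \<le> 1 - r\<^sup>2" "0 \<le> 1 - s\<^sup>2" using rs by (simp_all add: abs_square_le_1)
  show ?thesis
  proof (cases "r = s")
    case True
    then have "z = r" "ell3 \<rho> = 0" using assms(2) by (auto simp: z_H_def z_G_def eqs)
    then have "radius_sq \<rho> z = (ell1 \<rho>)\<^sup>2 + r\<^sup>2" by (simp add: radius_sq_def)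
    moreover have "sqrt ((1 - r\<^sup>2) * (1 - s\<^sup>2)) = 1 - r\<^sup>2" using True rs2 by simp
    ultimately show ?thesis using ell True by (simp add: power2_eq_square)
  next
    case False
    define \<alpha> where "\<alpha> = (z - s) / (r - s)"
    define \<beta> where "\<beta> = 1 - \<alpha>"
    have z: "z = \<alpha> * r + \<beta> * s"
      using False by (simp add: \<alpha>_def \<beta>_def divide_simps) (simp add: algebra_simps)
    have "z - z_0 \<rho> = (\<alpha> - \<beta>) * ((r - s) / 2)"
      unfolding z eqs \<beta>_def by (simp add: field_simps)
    then have "((z - z_0 \<rho>) / ell3 \<rho>)\<^sup>2 = (\<alpha> - \<beta>)\<^sup>2"
      using False by (simp add: eqs power_divide power_mult_distrib)
    then have m: "1 - ((z - z_0 \<rho>) / ell3 \<rho>)\<^sup>2 = 4 * \<alpha> * \<beta>"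
      by (simp add: \<beta>_def power2_eq_square algebra_simps)
    then have "0 \<le> 4 * \<alpha> * \<beta>" using height_param(1)[OF assms] by simp
    then have "(ell1 \<rho>)\<^sup>2 * (4 * \<alpha> * \<beta>) \<le> (1 - r * s + sqrt ((1 - r\<^sup>2) * (1 - s\<^sup>2))) / 2 * (4 * \<alpha> * \<beta>)"
      by (rule mult_right_mono[OF ell])
    then have "radius_sq \<rho> z \<le> (1 - r * s + sqrt ((1 - r\<^sup>2) * (1 - s\<^sup>2))) / 2 * (4 * \<alpha> * \<beta>)
        + (\<alpha> * r + \<beta> * s)\<^sup>2"
      unfolding radius_sq_def m using z by simp
    also have "\<dots> = 2 * \<alpha> * \<beta> + \<alpha>\<^sup>2 * r\<^sup>2 + \<beta>\<^sup>2 * s\<^sup>2 + 2 * \<alpha> * \<beta> * sqrt ((1 - r\<^sup>2) * (1 - s\<^sup>2))"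
      by (simp add: power2_eq_square field_simps)
    also have "\<dots> \<le> 2 * \<alpha> * \<beta> + \<alpha>\<^sup>2 * r\<^sup>2 + \<beta>\<^sup>2 * s\<^sup>2 + (\<alpha>\<^sup>2 * (1 - r\<^sup>2) + \<beta>\<^sup>2 * (1 - s\<^sup>2))"
      using weighted_amgm[OF rs2] by simp
    also have "\<dots> = (\<alpha> + \<beta>)\<^sup>2" by (simp add: power2_eq_square algebra_simps)
    finally show ?thesis by (simp add: \<beta>_def)
  qed
qed

lemma steering_ellipsoidI:
  assumes "n1\<^sup>2 + n2\<^sup>2 + n3\<^sup>2 = 1" "X = vector [ell1 \<rho> * n1, ell2 \<rho> * n2, z_0 \<rho> + ell3 \<rho> * n3]"
  shows "X \<in> steering_ellipsoid \<rho>"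
  using assms by (auto simp: steering_ellipsoid_def)

lemma steering_ellipsoidE:
  assumes "X \<in> steering_ellipsoid \<rho>"
  obtains n1 n2 n3 where "n1\<^sup>2 + n2\<^sup>2 + n3\<^sup>2 = 1"
    "X = vector [ell1 \<rho> * n1, ell2 \<rho> * n2, z_0 \<rho> + ell3 \<rho> * n3]"
    "\<bar>n1\<bar> \<le> 1" "\<bar>n2\<bar> \<le> 1" "\<bar>n3\<bar> \<le> 1"
proof -
  obtain n1 n2 n3 where n: "n1\<^sup>2 + n2\<^sup>2 + n3\<^sup>2 = 1"
    "X = vector [ell1 \<rho> * n1, ell2 \<rho> * n2, z_0 \<rho> + ell3 \<rho> * n3]"
    using assms by (auto simp: steering_ellipsoid_def)
  then have "n1\<^sup>2 \<le> 1" "n2\<^sup>2 \<le> 1" "n3\<^sup>2 \<le> 1"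
    using zero_le_power2[of n1] zero_le_power2[of n2] zero_le_power2[of n3] by linarith+
  with n that show thesis by (simp add: abs_square_le_1)
qed

lemma ellipse_subset: "ellipse \<rho> \<subseteq> steering_ellipsoid \<rho>"
  unfolding ellipse_def by (auto intro!: steering_ellipsoidI[of _ 0])

lemma points_in_ellipse:
  assumes "x_state \<rho>" "z \<in> {z_H \<rho>..z_G \<rho>}"
  shows "right_point \<rho> z \<in> ellipse \<rho>" "left_point \<rho> z \<in> ellipse \<rho>"
proof -
  define m where "m = (z - z_0 \<rho>) / ell3 \<rho>"
  have m: "m\<^sup>2 \<le> 1" "z = z_0 \<rho> + ell3 \<rho> * m"
    using height_param[OF assms] by (auto simp: m_def)
  have "(sqrt (1 - m\<^sup>2))\<^sup>2 + m\<^sup>2 = 1" "(- sqrt (1 - m\<^sup>2))\<^sup>2 + m\<^sup>2 = 1"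
    using m(1) by auto
  moreover have "right_point \<rho> z = vector [ell1 \<rho> * sqrt (1 - m\<^sup>2), 0, z_0 \<rho> + ell3 \<rho> * m]"
    "left_point \<rho> z = vector [ell1 \<rho> * - sqrt (1 - m\<^sup>2), 0, z_0 \<rho> + ell3 \<rho> * m]"
    using m(2) by (simp_all add: right_point_def left_point_def half_width_def m_def)
  ultimately show "right_point \<rho> z \<in> ellipse \<rho>" "left_point \<rho> z \<in> ellipse \<rho>"
    unfolding ellipse_def by blast+
qed

lemma ellipsoid_height:
  assumes "x_state \<rho>" "X \<in> steering_ellipsoid \<rho>"
  shows "X $ 3 \<in> {z_H \<rho>..z_G \<rho>}" "norm X \<le> norm (right_point \<rho> (X $ 3))"
proof -
  obtain n1 n2 n3 where n: "n1\<^sup>2 + n2\<^sup>2 + n3\<^sup>2 = 1"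
    "X = vector [ell1 \<rho> * n1, ell2 \<rho> * n2, z_0 \<rho> + ell3 \<rho> * n3]" "\<bar>n3\<bar> \<le> 1"
    using steering_ellipsoidE[OF assms(2)] by metis
  note e = ell1_nonneg[OF assms(1)] ell2_nonneg[OF assms(1)] ell2_le_ell1[OF assms(1)] ell3_nonneg[OF assms(1)]
  have "\<bar>ell3 \<rho> * n3\<bar> \<le> ell3 \<rho>"
    using e n(3) by (simp add: abs_mult mult_left_le)
  then show z: "X $ 3 \<in> {z_H \<rho>..z_G \<rho>}"
    using n(2) by (auto simp: z_H_def z_G_def)
  have "(ell2 \<rho>)\<^sup>2 * n2\<^sup>2 \<le> (ell1 \<rho>)\<^sup>2 * n2\<^sup>2"
    using e by (intro mult_right_mono power_mono) auto
  then have "(ell1 \<rho> * n1)\<^sup>2 + (ell2 \<rho> * n2)\<^sup>2 \<le> (ell1 \<rho>)\<^sup>2 * (n1\<^sup>2 + n2\<^sup>2)"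
    by (simp add: power_mult_distrib distrib_left)
  also have "\<dots> \<le> (ell1 \<rho>)\<^sup>2 * (1 - ((X $ 3 - z_0 \<rho>) / ell3 \<rho>)\<^sup>2)"
  \<comment> \<open>For \<open>ell3\<close> = 0 the quotient is 0, and only n1^2 + n2^2 <= 1
    remains.\<close>
  proof (rule mult_left_mono)
    have "n1\<^sup>2 + n2\<^sup>2 \<le> 1" using n(1) zero_le_power2[of n3] by linarith
    then show "n1\<^sup>2 + n2\<^sup>2 \<le> 1 - ((X $ 3 - z_0 \<rho>) / ell3 \<rho>)\<^sup>2"
      using n(1,2) by (cases "ell3 \<rho> = 0") auto
  qed simp
  finally have "(ell1 \<rho> * n1)\<^sup>2 + (ell2 \<rho> * n2)\<^sup>2 + (X $ 3)\<^sup>2 \<le> radius_sq \<rho> (X $ 3)"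
    by (simp add: radius_sq_def)
  then show "norm X \<le> norm (right_point \<rho> (X $ 3))"
    unfolding norm_at_height(1)[OF assms(1) z] using n(2) by (simp add: norm_vector3)
qed

text \<open>Each of these parameters is an extreme coordinate attained on the surface, hence
  monotone under inclusion. Applied both ways, this recovers the parameters from the surface as a
  mere set.\<close>

lemma ellipsoid_params_le:
  assumes "x_state \<rho>" "x_state \<rho>'" "steering_ellipsoid \<rho> \<subseteq> steering_ellipsoid \<rho>'"
  shows "ell1 \<rho> \<le> ell1 \<rho>'" "z_H \<rho>' \<le> z_H \<rho>" "z_G \<rho> \<le> z_G \<rho>'"
proof -
  have "vector [ell1 \<rho>, 0, z_0 \<rho>] \<in> steering_ellipsoid \<rho>"
    by (rule steering_ellipsoidI[of 1 0 0]) auto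
  then obtain n where n: "ell1 \<rho> = ell1 \<rho>' * n" "\<bar>n\<bar> \<le> 1"
    using assms(3) by (metis steering_ellipsoidE subsetD vector_3(1))
  then show "ell1 \<rho> \<le> ell1 \<rho>'"
    using ell1_nonneg[OF assms(2)] mult_left_le[of n "ell1 \<rho>'"] by (simp add: abs_le_iff)
  have "vector [0, 0, z_G \<rho>] \<in> steering_ellipsoid \<rho>"
    by (rule steering_ellipsoidI[of 0 0 1]) (auto simp: z_G_def)
  then show "z_G \<rho> \<le> z_G \<rho>'"
    using assms(3) ellipsoid_height(1)[OF assms(2), of "vector [0, 0, z_G \<rho>]"] by auto
  have "vector [0, 0, z_H \<rho>] \<in> steering_ellipsoid \<rho>"
    by (rule steering_ellipsoidI[of 0 0 "- 1"]) (auto simp: z_H_def)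
  then show "z_H \<rho>' \<le> z_H \<rho>"
    using assms(3) ellipsoid_height(1)[OF assms(2), of "vector [0, 0, z_H \<rho>]"] by auto
qed

lemma ellipsoid_params_eq:
  assumes "x_state \<rho>" "x_state \<rho>'" "steering_ellipsoid \<rho> = steering_ellipsoid \<rho>'"
  shows "ell1 \<rho> = ell1 \<rho>'" "z_H \<rho> = z_H \<rho>'" "z_G \<rho> = z_G \<rho>'" "z_0 \<rho> = z_0 \<rho>'" "ell3 \<rho> = ell3 \<rho>'"
proof -
  show e: "ell1 \<rho> = ell1 \<rho>'" "z_H \<rho> = z_H \<rho>'" "z_G \<rho> = z_G \<rho>'"
    using ellipsoid_params_le[of \<rho> \<rho>'] ellipsoid_params_le[of \<rho>' \<rho>] assms by auto
  show "z_0 \<rho> = z_0 \<rho>'" "ell3 \<rho> = ell3 \<rho>'"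
    using e(2,3) by (auto simp: z_H_def z_G_def)
qed

text \<open>Reweighting the two measurement outcomes on \<open>A\<close> moves the barycentre without changing
  the ellipsoid.\<close>

lemma state_with_barycentre:
  assumes "x_state \<rho>" "z_H \<rho> < z" "z < z_G \<rho>"
  obtains \<rho>' where "\<rho>' \<in> states_with_ellipsoid (steering_ellipsoid \<rho>)" "z_B \<rho>' = z"
proof -
  obtain a b c d u v where nonneg: "0 \<le> a" "0 \<le> b" "0 \<le> c" "0 \<le> d" "0 \<le> u" "0 \<le> v"
    and sum: "a + b + c + d = 1" and uv: "u\<^sup>2 \<le> a * d" "v\<^sup>2 \<le> b * c"
    and pos: "(a + b) * (c + d) > 0" and \<rho>: "\<rho> = x_matrix a b c d u v"
    using assms by (auto simp: x_state_def)
  define l m where "l = a + b" and "m = c + d"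
  have l: "0 < l" "0 < m" and lm: "m = 1 - l"
    using pos nonneg sum by (auto simp: l_def m_def zero_less_mult_iff)
  define r s where "r = (a - b) / l" and "s = (c - d) / m"
  have N: "norm_AB \<rho> = l * m" by (simp add: norm_AB_def \<rho> l_def m_def)
  have "a = l * (1 + r) / 2" "b = l * (1 - r) / 2" "c = m * (1 + s) / 2" "d = m * (1 - s) / 2"
  proof -
    have "l * r = a - b" "m * s = c - d" using l by (simp_all add: r_def s_def)
    then show "a = l * (1 + r) / 2" "b = l * (1 - r) / 2" "c = m * (1 + s) / 2" "d = m * (1 - s) / 2"
      by (simp_all add: distrib_left right_diff_distrib) (simp_all add: l_def m_def)
  qed
  note abcd = this
  have E: "a * c - b * d = (l * m) * ((r + s) / 2)" "a * d - b * c = (l * m) * ((r - s) / 2)"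
    unfolding abcd by (simp_all add: field_simps)
  have z0: "z_0 \<rho> = (r + s) / 2"
    unfolding z_0_def N unfolding \<rho> ent_x_matrix E using l by simp
  have e3: "ell3 \<rho> = \<bar>r - s\<bar> / 2"
    unfolding ell3_def N unfolding \<rho> ent_x_matrix E using l by (simp add: abs_mult)
  have z: "min r s < z" "z < max r s"
    using assms(2,3) by (auto simp: z_H_def z_G_def z0 e3 min_def max_def abs_if field_simps split: if_splits)
  \<comment> \<open>The new outcome probabilities are the barycentric weights of \<open>z\<close>
    with respect to r and s.\<close>
  define l' m' where "l' = (z - s) / (r - s)" and "m' = (r - z) / (r - s)"
  have "r \<noteq> s" using z by auto
  then have lm': "l' + m' = 1" "l' * r + m' * s = z"
    by (auto simp: l'_def m'_def divide_simps) (auto simp: algebra_simps)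
  have l': "0 < l'" "0 < m'"
    using z by (auto simp: l'_def m'_def min_def max_def zero_less_divide_iff split: if_splits)
  define x y where "x = l' / l" and "y = m' / m"
  have xy: "0 < x" "0 < y" using l l' by (auto simp: x_def y_def)
  \<comment> \<open>This is a local filter diag(sqrt x, sqrt y) on A. It multiplies u, v and the
    root of \<open>norm_AB\<close> by \<open>k\<close>, and the differences ad - bc and ac - bd and
    \<open>norm_AB\<close> itself by k^2, so all ratios survive.\<close>
  define k where "k = sqrt (x * y)"
  have k: "0 < k" "k\<^sup>2 = x * y" using xy by (auto simp: k_def)
  define \<rho>' where "\<rho>' = x_matrix (x * a) (x * b) (y * c) (y * d) (k * u) (k * v)"
  have xl: "x * a + x * b = l'" "y * c + y * d = m'"
    unfolding distrib_left[symmetric] l_def[symmetric] m_def[symmetric] x_def y_def using l by simp_all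
  have N': "norm_AB \<rho>' = k\<^sup>2 * norm_AB \<rho>"
    unfolding k(2) by (simp add: norm_AB_def \<rho>'_def \<rho> algebra_simps)
  have sqrtN': "sqrt (norm_AB \<rho>') = k * sqrt (norm_AB \<rho>)"
    unfolding N' using k(1) by (simp add: real_sqrt_mult)
  have "x_state \<rho>'"
    unfolding x_state_def
  proof (intro exI conjI)
    show "x * a + x * b + y * c + y * d = 1" using xl lm' by simp
    show "(k * u)\<^sup>2 \<le> (x * a) * (y * d)" "(k * v)\<^sup>2 \<le> (x * b) * (y * c)"
      using mult_left_mono[OF uv(1), of "x * y"] mult_left_mono[OF uv(2), of "x * y"] xy
      by (simp_all add: power_mult_distrib k mult_ac)
    show "0 < (x * a + x * b) * (y * c + y * d)" unfolding xl using l' by simp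
    show "\<rho>' = x_matrix (x * a) (x * b) (y * c) (y * d) (k * u) (k * v)" by (fact \<rho>'_def)
  qed (use nonneg xy k in auto)
  moreover have "ell1 \<rho>' = ell1 \<rho>"
    unfolding ell1_def sqrtN' using k by (simp add: \<rho>'_def \<rho> flip: distrib_left)
  moreover have "ell2 \<rho>' = ell2 \<rho>"
    unfolding ell2_def sqrtN' using k by (simp add: \<rho>'_def \<rho> abs_mult flip: right_diff_distrib)
  moreover have "ell3 \<rho>' = ell3 \<rho>"
  proof -
    have "x * a * (y * d) - x * b * (y * c) = (x * y) * (a * d - b * c)" by (simp add: algebra_simps)
    then show ?thesis
      unfolding ell3_def N' k(2) using xy by (simp add: \<rho>'_def \<rho> abs_mult)
  qed
  moreover have "z_0 \<rho>' = z_0 \<rho>"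
  proof -
    have "x * a * (y * c) - x * b * (y * d) = (x * y) * (a * c - b * d)" by (simp add: algebra_simps)
    then show ?thesis
      unfolding z_0_def N' k(2) using xy by (simp add: \<rho>'_def \<rho>)
  qed
  ultimately have "\<rho>' \<in> states_with_ellipsoid (steering_ellipsoid \<rho>)"
    by (simp add: states_with_ellipsoid_def steering_ellipsoid_def)
  moreover have "z_B \<rho>' = l' * r + m' * s"
    using l by (simp add: z_B_def \<rho>'_def r_def s_def x_def y_def field_simps)
  ultimately show thesis using that lm' by simp
qed

section \<open>Optimal decompositions\<close>

definition height_entropy :: "complex^4^4 \<Rightarrow> real \<Rightarrow> real" where
  "height_entropy \<rho> z = entropy (right_point \<rho> z)"

lemma entropy_at_height:
  assumes "x_state \<rho>" "z \<in> {z_H \<rho>..z_G \<rho>}"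
  shows "height_entropy \<rho> z = sq_entropy (radius_sq \<rho> z)" "entropy (left_point \<rho> z) = height_entropy \<rho> z"
  by (simp_all add: height_entropy_def entropy_def norm_at_height[OF assms] sq_entropy_def)

lemma entropy_ge_height_entropy:
  assumes "x_state \<rho>" "X \<in> steering_ellipsoid \<rho>"
  shows "height_entropy \<rho> (X $ 3) \<le> entropy X"
proof -
  note z = ellipsoid_height[OF assms]
  have "norm (right_point \<rho> (X $ 3)) \<le> 1"
    unfolding norm_at_height(1)[OF assms(1) z(1)] using radius_sq_le_1[OF assms(1) z(1)] by simp
  then show ?thesis
    unfolding height_entropy_def entropy_def using z(2) by (intro bin_entropy_antimono) auto
qed

lemma sum_list_affine:
  fixes D :: "(real \<times> (real^3)) list"
  shows "(\<Sum>(p, X)\<leftarrow>D. p * (c + d * X $ 3)) = c * (\<Sum>(p, X)\<leftarrow>D. p) + d * (\<Sum>(p, X)\<leftarrow>D. p *\<^sub>R X) $ 3"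
proof (induction D)
  case (Cons a D)
  obtain p X where "a = (p, X)" by force
  then show ?case using Cons.IH by (simp add: distrib_left mult_ac)
qed simp

text \<open>Weak duality: an affine function of the height averages over any decomposition to its
  value at the barycentre.\<close>

lemma average_entropy_ge:
  assumes x: "x_state \<rho>" and D: "decomposition \<rho> D"
    and min: "minorant {z_H \<rho>..z_G \<rho>} (height_entropy \<rho>) c d"
  shows "c + d * z_B \<rho> \<le> average_entropy D"
proof -
  have "c + d * z_B \<rho> = (\<Sum>(p, X)\<leftarrow>D. p * (c + d * X $ 3))"
    using D unfolding decomposition_def sum_list_affine by (simp add: bloch_B_x_state[OF x])
  also have "\<dots> \<le> (\<Sum>(p, X)\<leftarrow>D. p * entropy X)"
  proof (rule sum_list_mono)
    fix a assume "a \<in> set D"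
    moreover obtain p X where a: "a = (p, X)" by force
    ultimately have "0 \<le> p" "X \<in> steering_ellipsoid \<rho>"
      using D by (auto simp: decomposition_def)
    moreover have "c + d * X $ 3 \<le> entropy X" if "X \<in> steering_ellipsoid \<rho>"
      using min ellipsoid_height(1)[OF x that] entropy_ge_height_entropy[OF x that]
      unfolding minorant_def by (meson order_trans)
    ultimately show "(case a of (p, X) \<Rightarrow> p * (c + d * X $ 3)) \<le> (case a of (p, X) \<Rightarrow> p * entropy X)"
      by (simp add: a mult_left_mono)
  qed
  finally show ?thesis by (simp add: average_entropy_def)
qed

lemma optimalI:
  assumes "x_state \<rho>" "decomposition \<rho> D" "minorant {z_H \<rho>..z_G \<rho>} (height_entropy \<rho>) c d"
    and "average_entropy D = c + d * z_B \<rho>"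
  shows "optimal \<rho> D"
  using assms average_entropy_ge unfolding optimal_def by metis

lemma vector3_simps:
  "vector [x, y, z] + vector [x', y', z'] = (vector [x + x', y + y', z + z'] :: real^3)"
  "c *\<^sub>R vector [x, y, z] = (vector [c * x, c * y, c * z] :: real^3)"
  by (simp_all add: vec3_eq_iff)

lemma horizontal_decomposition:
  assumes "x_state \<rho>"
  shows "decomposition \<rho> (horizontal_decomposition \<rho>)"
    and "average_entropy (horizontal_decomposition \<rho>) = height_entropy \<rho> (z_B \<rho>)"
proof -
  have z: "z_B \<rho> \<in> {z_H \<rho>..z_G \<rho>}" using x_state_z_B[OF assms] by simp
  have "(1 / 2) *\<^sub>R right_point \<rho> (z_B \<rho>) + (1 / 2) *\<^sub>R left_point \<rho> (z_B \<rho>) = bloch_B \<rho>"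
    unfolding bloch_B_x_state[OF assms] right_point_def left_point_def vector3_simps by simp
  then show "decomposition \<rho> (horizontal_decomposition \<rho>)"
    using points_in_ellipse[OF assms z] ellipse_subset[of \<rho>]
    by (auto simp: decomposition_def horizontal_decomposition_def)
  show "average_entropy (horizontal_decomposition \<rho>) = height_entropy \<rho> (z_B \<rho>)"
    using entropy_at_height(2)[OF assms z]
    by (simp add: average_entropy_def horizontal_decomposition_def height_entropy_def)
qed

lemma horizontal_optimal_of_supported:
  assumes "x_state \<rho>" "supported {z_H \<rho>..z_G \<rho>} (height_entropy \<rho>) (z_B \<rho>)"
  shows "horizontal_optimal \<rho>"
  using assms horizontal_decomposition[OF assms(1)]
  by (auto simp: horizontal_optimal_def supported_def intro: optimalI)

section \<open>Vertical and three-state decompositions\<close>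

lemma vertices:
  assumes "0 < ell3 \<rho>"
  shows "right_point \<rho> (z_G \<rho>) = vertex_G \<rho>" "right_point \<rho> (z_H \<rho>) = vertex_H \<rho>"
  using assms by (simp_all add: right_point_def half_width_def vertex_G_def vertex_H_def z_G_def z_H_def)

lemma z_H_le_z_G: "x_state \<rho> \<Longrightarrow> z_H \<rho> \<le> z_G \<rho>"
  using ell3_nonneg[of \<rho>] by (simp add: z_H_def z_G_def)

lemma vertices_in_ellipse:
  assumes "x_state \<rho>" "0 < ell3 \<rho>"
  shows "vertex_G \<rho> \<in> ellipse \<rho>" "vertex_H \<rho> \<in> ellipse \<rho>"
  using points_in_ellipse(1)[OF assms(1)] vertices[OF assms(2)] z_H_le_z_G[OF assms(1)]
  by (metis atLeastAtMost_iff order_refl)+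

lemma vertical_optimal_of_chord:
  assumes x: "x_state \<rho>" and e: "0 < ell3 \<rho>"
    and chord: "chord_optimal (z_H \<rho>) (z_G \<rho>) (height_entropy \<rho>)"
  shows "vertical_optimal \<rho>"
proof -
  obtain c d where min: "minorant {z_H \<rho>..z_G \<rho>} (height_entropy \<rho>) c d"
    and ends: "height_entropy \<rho> (z_H \<rho>) = c + d * z_H \<rho>" "height_entropy \<rho> (z_G \<rho>) = c + d * z_G \<rho>"
    using chord by (auto simp: chord_optimal_def)
  define l where "l = (z_B \<rho> - z_H \<rho>) / (z_G \<rho> - z_H \<rho>)"
  note zs = x_state_z_B(3,4)[OF x e]
  have l: "0 \<le> l" "l \<le> 1" using zs by (auto simp: l_def divide_simps)
  have bary: "l * z_G \<rho> + (1 - l) * z_H \<rho> = z_B \<rho>"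
  proof -
    have "l * (z_G \<rho> - z_H \<rho>) = z_B \<rho> - z_H \<rho>" using zs by (simp add: l_def)
    then show ?thesis by (simp add: algebra_simps)
  qed
  define D where "D = [(l, vertex_G \<rho>), (1 - l, vertex_H \<rho>)]"
  have dec: "decomposition \<rho> D"
    using l vertices_in_ellipse[OF x e] ellipse_subset[of \<rho>] bary
    by (auto simp: decomposition_def D_def bloch_B_x_state[OF x] vertex_G_def vertex_H_def vector3_simps)
  have "average_entropy D = l * height_entropy \<rho> (z_G \<rho>) + (1 - l) * height_entropy \<rho> (z_H \<rho>)"
    by (simp add: average_entropy_def D_def height_entropy_def vertices[OF e])
  also have "\<dots> = c + d * (l * z_G \<rho> + (1 - l) * z_H \<rho>)"
    unfolding ends by (simp add: algebra_simps)
  finally have "average_entropy D = c + d * z_B \<rho>" by (simp only: bary)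
  then have "optimal \<rho> D" by (rule optimalI[OF x dec min])
  with dec show ?thesis
    unfolding vertical_optimal_def vertical_decomposition_def D_def by blast
qed

text \<open>Both triangles are treated at once, with \<open>w\<close> the height of the vertex.
  Equal weights cancel the horizontal coordinates, so conditions on the weights and heights are all
  that remains.\<close>

lemma three_state:
  fixes p q :: real
  assumes x: "x_state \<rho>" and e: "0 < ell3 \<rho>"
    and z: "z \<in> {z_H \<rho>..z_G \<rho>}" and w: "w \<in> {z_H \<rho>, z_G \<rho>}"
  defines "D \<equiv> [(p, vector [0, 0, w]), (q, right_point \<rho> z), (q, left_point \<rho> z)]"
  shows "average_entropy D = p * height_entropy \<rho> w + 2 * q * height_entropy \<rho> z"
    and "decomposition \<rho> D \<longleftrightarrow> 0 \<le> p \<and> 0 \<le> q \<and> p + 2 * q = 1 \<and> p * w + 2 * q * z = z_B \<rho>"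
proof -
  have v: "right_point \<rho> w = vector [0, 0, w]"
    using w vertices[OF e] by (auto simp: vertex_G_def vertex_H_def)
  have w': "w \<in> {z_H \<rho>..z_G \<rho>}" using w z_H_le_z_G[OF x] by auto
  have in_E: "vector [0, 0, w] \<in> steering_ellipsoid \<rho>" "right_point \<rho> z \<in> steering_ellipsoid \<rho>"
    "left_point \<rho> z \<in> steering_ellipsoid \<rho>"
    using points_in_ellipse[OF x z] points_in_ellipse(1)[OF x w'] ellipse_subset[of \<rho>] by (auto simp: v)
  show "average_entropy D = p * height_entropy \<rho> w + 2 * q * height_entropy \<rho> z"
    using entropy_at_height(2)[OF x z] by (simp add: average_entropy_def D_def height_entropy_def v)
  have "p *\<^sub>R vector [0, 0, w] + (q *\<^sub>R right_point \<rho> z + q *\<^sub>R left_point \<rho> z) =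
      (vector [0, 0, p * w + 2 * q * z] :: real^3)"
    unfolding right_point_def left_point_def vector3_simps by (simp add: mult.assoc)
  moreover have "(vector [0, 0, y] :: real^3) = vector [0, 0, y'] \<longleftrightarrow> y = y'" for y y'
    by (simp add: vec3_eq_iff)
  ultimately show "decomposition \<rho> D \<longleftrightarrow> 0 \<le> p \<and> 0 \<le> q \<and> p + 2 * q = 1 \<and> p * w + 2 * q * z = z_B \<rho>"
    using in_E by (auto simp: decomposition_def D_def bloch_B_x_state[OF x])
qed

text \<open>The tangent certifies the three-state decomposition. Its strictness away from the two
  contact heights excludes the horizontal decomposition at a height between them, and forces every
  optimal three-state decomposition onto the contact heights.\<close>

lemma three_state_of_tangent:
  assumes x: "x_state \<rho>" and e: "0 < ell3 \<rho>" and e1: "0 < ell1 \<rho>"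
    and t: "z_H \<rho> < t" "t < z_G \<rho>" and w: "w \<in> {z_H \<rho>, z_G \<rho>}"
    and touch: "height_entropy \<rho> t = c + d * t" "height_entropy \<rho> w = c + d * w"
    and above: "\<And>z. z \<in> {z_H \<rho>..z_G \<rho>} - {t, w} \<Longrightarrow> c + d * z < height_entropy \<rho> z"
    and between: "z_B \<rho> \<in> open_segment t w"
  shows "\<not> horizontal_optimal \<rho>" "\<exists>D. optimal_three_state \<rho> D"
    and "\<And>D. optimal_three_state \<rho> D \<Longrightarrow>
      snd ` set D = {vector [0, 0, w], right_point \<rho> t, left_point \<rho> t}"
proof -
  have t': "t \<in> {z_H \<rho>..z_G \<rho>}" using t by simp
  have "t \<noteq> w" using t w by auto
  define p q where "p = (z_B \<rho> - t) / (w - t)" and "q = (1 - p) / 2"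
  have p: "0 < p" "p < 1"
    using between by (auto simp: p_def open_segment_eq_real_ivl divide_simps split: if_splits)
  then have q: "0 < q" by (simp add: q_def)
  have "p * (w - t) = z_B \<rho> - t" using \<open>t \<noteq> w\<close> by (simp add: p_def)
  moreover have q2: "2 * q = 1 - p" by (simp add: q_def)
  ultimately have bary: "p * w + 2 * q * t = z_B \<rho>" "p + 2 * q = 1"
    unfolding q2 by (simp_all add: algebra_simps)
  define D where "D = [(p, vector [0, 0, w]), (q, right_point \<rho> t), (q, left_point \<rho> t)]"
  have dec: "decomposition \<rho> D"
    unfolding D_def three_state(2)[OF x e t' w] using p q bary by simp
  have "average_entropy D = c * (p + 2 * q) + d * (p * w + 2 * q * t)"
    unfolding D_def three_state(1)[OF x e t' w] touch by (simp add: algebra_simps)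
  then have avg: "average_entropy D = c + d * z_B \<rho>" by (simp add: bary)
  have min: "minorant {z_H \<rho>..z_G \<rho>} (height_entropy \<rho>) c d"
    unfolding minorant_def using above touch by (metis DiffI insertE less_imp_le order_refl singletonD)
  have opt: "optimal \<rho> D" by (rule optimalI[OF x dec min avg])
  \<comment> \<open>A positive width makes the left and right points differ, as a three-state
    decomposition requires.\<close>
  have "0 < half_width \<rho> t"
  proof -
    have "\<bar>(t - z_0 \<rho>) / ell3 \<rho>\<bar> < 1"
      using t e by (auto simp: z_H_def z_G_def abs_less_iff divide_simps)
    then show ?thesis using e1 by (simp add: half_width_def abs_square_less_1)
  qed
  then have dist: "distinct (map snd D)"
    using \<open>t \<noteq> w\<close> by (auto simp: D_def right_point_def left_point_def vec3_eq_iff)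
  have "upper_triangle \<rho> D \<or> lower_triangle \<rho> D"
  proof (cases "w = z_G \<rho>")
    case True
    then have "z_H \<rho> < t \<and> t < z_B \<rho>"
      using between t by (auto simp: open_segment_eq_real_ivl)
    with True dec p q show ?thesis
      unfolding upper_triangle_def D_def vertex_G_def by blast
  next
    case False
    then have "w = z_H \<rho>" using w by simp
    moreover from this have "z_B \<rho> < t \<and> t < z_G \<rho>"
      using between t by (auto simp: open_segment_eq_real_ivl)
    ultimately show ?thesis
      using dec p q unfolding lower_triangle_def D_def vertex_H_def by blast
  qed
  with dist opt show "\<exists>D. optimal_three_state \<rho> D"
    by (auto simp: optimal_three_state_def three_state_decomposition_def)
  have "z_B \<rho> \<in> {z_H \<rho>..z_G \<rho>} - {t, w}"
    using x_state_z_B[OF x] between by (auto simp: open_segment_def)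
  then have "average_entropy D < average_entropy (horizontal_decomposition \<rho>)"
    unfolding avg horizontal_decomposition(2)[OF x] by (rule above)
  with dec show "\<not> horizontal_optimal \<rho>"
    unfolding horizontal_optimal_def optimal_def by force
  fix D' assume D': "optimal_three_state \<rho> D'"
  then have opt': "optimal \<rho> D'" and "upper_triangle \<rho> D' \<or> lower_triangle \<rho> D'"
    by (auto simp: optimal_three_state_def three_state_decomposition_def)
  from this(2) obtain p' q' w' z where p': "0 < p'" "0 < q'"
    and w': "w' \<in> {z_H \<rho>, z_G \<rho>}" and z: "z \<in> {z_H \<rho>..z_G \<rho>}" "z \<noteq> w'"
    and eq: "D' = [(p', vector [0, 0, w']), (q', right_point \<rho> z), (q', left_point \<rho> z)]"
  proof
    assume "upper_triangle \<rho> D'"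
    then obtain p q z where "0 < p" "0 < q" "z_H \<rho> < z" "z < z_B \<rho>"
      "D' = [(p, vertex_G \<rho>), (q, right_point \<rho> z), (q, left_point \<rho> z)]"
      unfolding upper_triangle_def by blast
    then show thesis
      using x_state_z_B(2)[OF x] by (intro that[of p q "z_G \<rho>" z]) (auto simp: vertex_G_def)
  next
    assume "lower_triangle \<rho> D'"
    then obtain p q z where "0 < p" "0 < q" "z_B \<rho> < z" "z < z_G \<rho>"
      "D' = [(p, vertex_H \<rho>), (q, right_point \<rho> z), (q, left_point \<rho> z)]"
      unfolding lower_triangle_def by blast
    then show thesis
      using x_state_z_B(1)[OF x] by (intro that[of p q "z_H \<rho>" z]) (auto simp: vertex_H_def)
  qed
  have "decomposition \<rho> D'" using opt' by (simp add: optimal_def)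
  then have bary': "p' + 2 * q' = 1" "p' * w' + 2 * q' * z = z_B \<rho>"
    unfolding eq three_state(2)[OF x e z(1) w'] by auto
  \<comment> \<open>Complementary slackness: the nonnegative gap \<open>u\<close> must vanish
    wherever an optimal decomposition puts positive weight.\<close>
  define u where "u y = height_entropy \<rho> y - (c + d * y)" for y
  have u: "0 \<le> u y" if "y \<in> {z_H \<rho>..z_G \<rho>}" for y
    using min that by (simp add: u_def minorant_def)
  have "average_entropy D' \<le> average_entropy D"
    using opt' dec by (simp add: optimal_def)
  then have "p' * height_entropy \<rho> w' + 2 * q' * height_entropy \<rho> z
      \<le> c * (p' + 2 * q') + d * (p' * w' + 2 * q' * z)"
    unfolding avg eq three_state(1)[OF x e z(1) w'] bary' by simp
  then have "p' * u w' + 2 * q' * u z \<le> 0"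
    by (simp add: u_def algebra_simps)
  moreover have uw: "0 \<le> u w'" and uz: "0 \<le> u z"
    using u w' z z_H_le_z_G[OF x] by auto
  ultimately have "p' * u w' = 0" "2 * q' * u z = 0"
    using p' mult_nonneg_nonneg[of p' "u w'"] mult_nonneg_nonneg[of "2 * q'" "u z"] by linarith+
  then have "u w' = 0" "u z = 0" using p' by auto
  moreover have "y \<in> {t, w}" if "y \<in> {z_H \<rho>..z_G \<rho>}" "u y = 0" for y
    using above[of y] that by (force simp: u_def)
  moreover have "w' \<in> {z_H \<rho>..z_G \<rho>}" using w' z_H_le_z_G[OF x] by auto
  ultimately have "w' \<in> {t, w}" "z \<in> {t, w}" using z(1) by blast+
  \<comment> \<open>The vertex height cannot be \<open>t\<close>, which is interior; so it is
    \<open>w\<close>, and the other height, being different, is \<open>t\<close>.\<close>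
  moreover have "w' \<noteq> t" using w' t by auto
  ultimately have "w' = w" "z = t" using z by auto
  then show "snd ` set D' = {vector [0, 0, w], right_point \<rho> t, left_point \<rho> t}"
    by (simp add: eq)
qed

text \<open>The squared distance has leading coefficient 1 - k, where k is the squared ratio of the
  half-axes. The tangent case can come only from k > 1, which also makes \<open>ell1\<close>
  positive.\<close>

lemma height_entropy_trichotomy:
  assumes x: "x_state \<rho>" and e: "0 < ell3 \<rho>"
  shows "(\<forall>z\<in>{z_H \<rho><..<z_G \<rho>}. supported {z_H \<rho>..z_G \<rho>} (height_entropy \<rho>) z) \<or>
    chord_optimal (z_H \<rho>) (z_G \<rho>) (height_entropy \<rho>) \<or>
    0 < ell1 \<rho> \<and> tangent_optimal (z_H \<rho>) (z_G \<rho>) (height_entropy \<rho>)"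
proof -
  define k where "k = (ell1 \<rho> / ell3 \<rho>)\<^sup>2"
  define p q where "p = z_H \<rho>" and "q = z_G \<rho>"
  have pq: "p < q" using e by (simp add: p_def q_def z_H_def z_G_def)
  have rad: "radius_sq \<rho> z = (ell1 \<rho>)\<^sup>2 - k * (z - z_0 \<rho>)\<^sup>2 + z\<^sup>2" for z
    by (simp add: radius_sq_def k_def power_divide power_mult_distrib right_diff_distrib)
  have bounds: "0 \<le> radius_sq \<rho> z" "radius_sq \<rho> z \<le> 1" if "z \<in> {p..q}" for z
    using that radius_sq_nonneg[OF x] radius_sq_le_1[OF x] by (auto simp: p_def q_def)
  have h: "height_entropy \<rho> z = sq_entropy (radius_sq \<rho> z)" if "z \<in> {p..q}" for z
    using that entropy_at_height(1)[OF x] by (auto simp: p_def q_def)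
  show ?thesis
  proof (cases "k \<le> 1")
    case True
    define d where "d = (height_entropy \<rho> q - height_entropy \<rho> p) / (q - p)"
    have "height_entropy \<rho> p + d * (z - p) \<le> height_entropy \<rho> z" if z: "z \<in> {p..q}" for z
    proof -
      define l where "l = (z - p) / (q - p)"
      have l: "0 \<le> l" "l \<le> 1" "z = (1 - l) * p + l * q"
        using z pq by (auto simp: l_def divide_simps) (simp add: algebra_simps)
      have "radius_sq \<rho> z + (1 - k) * (l * (1 - l)) * (q - p)\<^sup>2
          = (1 - l) * radius_sq \<rho> p + l * radius_sq \<rho> q"
        unfolding rad l(3) by (simp add: power2_eq_square algebra_simps)
      moreover have "0 \<le> (1 - k) * (l * (1 - l)) * (q - p)\<^sup>2"
        using True l by simp
      ultimately have le: "radius_sq \<rho> z \<le> (1 - l) * radius_sq \<rho> p + l * radius_sq \<rho> q" by linarith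
      have pq': "p \<in> {p..q}" "q \<in> {p..q}" using pq by auto
      have "(1 - l) * height_entropy \<rho> p + l * height_entropy \<rho> q
          \<le> sq_entropy ((1 - l) * radius_sq \<rho> p + l * radius_sq \<rho> q)"
        unfolding h[OF pq'(1)] h[OF pq'(2)] using bounds[OF pq'(1)] bounds[OF pq'(2)] l
        by (intro sq_entropy_concave) auto
      also have "\<dots> \<le> sq_entropy (radius_sq \<rho> z)"
        using bounds[OF z] bounds[OF pq'(1)] bounds[OF pq'(2)] l
        by (intro sq_entropy_antimono le convex_bound_le) auto
      also have "\<dots> = height_entropy \<rho> z" using h[OF z] by simp
      finally show ?thesis
        by (simp add: d_def l_def algebra_simps diff_divide_distrib)
    qed
    moreover have "height_entropy \<rho> p + d * (q - p) = height_entropy \<rho> q"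
      using pq by (simp add: d_def)
    ultimately have "chord_optimal p q (height_entropy \<rho>)"
      unfolding chord_optimal_def minorant_def
      by (intro exI[of _ "height_entropy \<rho> p - d * p"] exI[of _ d]) (auto simp: algebra_simps)
    then show ?thesis by (simp add: p_def q_def)
  next
    case False
    define \<kappa> where "\<kappa> = k - 1"
    \<comment> \<open>Completing the square in the height: \<open>w\<close> is the apex and
      \<open>M\<close> the value there.\<close>
    define w where "w = k * z_0 \<rho> / \<kappa>"
    define M where "M = (ell1 \<rho>)\<^sup>2 - k * (z_0 \<rho>)\<^sup>2 + \<kappa> * w\<^sup>2"
    have \<kappa>: "0 < \<kappa>" using False by (simp add: \<kappa>_def)
    have "ell1 \<rho> \<noteq> 0" using False by (auto simp: k_def)
    then have e1: "0 < ell1 \<rho>" using ell1_nonneg[OF x] by simp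
    have rad': "M - \<kappa> * (z - w)\<^sup>2 = radius_sq \<rho> z" for z
    proof -
      have "\<kappa> * w = k * z_0 \<rho>" using \<kappa> by (simp add: w_def)
      then have "M - \<kappa> * (z - w)\<^sup>2 = (ell1 \<rho>)\<^sup>2 - k * (z_0 \<rho>)\<^sup>2 - \<kappa> * z\<^sup>2 + 2 * (k * z_0 \<rho>) * z"
        by (simp add: M_def power2_diff algebra_simps)
      also have "\<dots> = radius_sq \<rho> z"
        by (simp add: rad \<kappa>_def power2_diff algebra_simps)
      finally show ?thesis .
    qed
    have eq: "arc_entropy M \<kappa> w z = height_entropy \<rho> z" if "z \<in> {p..q}" for z
      using h[OF that] by (simp add: arc_entropy_def rad')
    have "(\<forall>z\<in>{p<..<q}. supported {p..q} (arc_entropy M \<kappa> w) z) \<or>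
        chord_optimal p q (arc_entropy M \<kappa> w) \<or> tangent_optimal p q (arc_entropy M \<kappa> w)"
      by (rule arc_entropy_trichotomy[OF pq \<kappa>]) (use bounds in \<open>simp add: rad'\<close>)
    moreover have "minorant {p..q} (arc_entropy M \<kappa> w) c d \<longleftrightarrow> minorant {p..q} (height_entropy \<rho>) c d" for c d
      using eq by (simp add: minorant_def)
    then have supp: "supported {p..q} (arc_entropy M \<kappa> w) z \<longleftrightarrow> supported {p..q} (height_entropy \<rho>) z"
      if "z \<in> {p<..<q}" for z
      using eq[of z] that by (simp add: supported_def)
    moreover have "chord_optimal p q (arc_entropy M \<kappa> w) \<longleftrightarrow> chord_optimal p q (height_entropy \<rho>)"
      using eq pq by (simp add: chord_optimal_def minorant_def)
    moreover have "tangent_optimal p q (arc_entropy M \<kappa> w) \<longleftrightarrow> tangent_optimal p q (height_entropy \<rho>)"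
      unfolding tangent_optimal_def using eq supp pq by simp
    ultimately show ?thesis using e1 by (auto simp: p_def q_def)
  qed
qed

theorem mainTheorem1:
  fixes \<rho>0 :: "complex^4^4" and \<EE> :: "(real^3) set"
  assumes "x_state \<rho>0"
    and "\<EE> = steering_ellipsoid \<rho>0"
  shows "type_horizontal \<EE> \<or> type_vertical \<EE> \<or> type_triangle \<EE>"
proof -
  note x0 = assms(1)
  have st: "x_state \<rho>" "ell1 \<rho> = ell1 \<rho>0" "z_H \<rho> = z_H \<rho>0" "z_G \<rho> = z_G \<rho>0" "z_0 \<rho> = z_0 \<rho>0"
    "ell3 \<rho> = ell3 \<rho>0" if "\<rho> \<in> states_with_ellipsoid \<EE>" for \<rho>
    using that ellipsoid_params_eq[of \<rho> \<rho>0] x0 assms(2) by (auto simp: states_with_ellipsoid_def)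
  have pts: "right_point \<rho> = right_point \<rho>0" "left_point \<rho> = left_point \<rho>0"
    "height_entropy \<rho> = height_entropy \<rho>0" if "\<rho> \<in> states_with_ellipsoid \<EE>" for \<rho>
    using st[OF that] by (simp_all add: fun_eq_iff right_point_def left_point_def half_width_def height_entropy_def)
  have hor: "horizontal_optimal \<rho>"
    if "\<rho> \<in> states_with_ellipsoid \<EE>" "supported {z_H \<rho>0..z_G \<rho>0} (height_entropy \<rho>0) (z_B \<rho>)" for \<rho>
    using horizontal_optimal_of_supported[of \<rho>] st[OF that(1)] pts[OF that(1)] that(2) by simp
  show ?thesis
  proof (cases "ell3 \<rho>0 = 0")
    case True
    \<comment> \<open>All points share one height here, so the interval is a single point and any
      slope supports; 0 is chosen.\<close>
    have "supported {z_H \<rho>0..z_G \<rho>0} (height_entropy \<rho>0) (z_B \<rho>)" if "\<rho> \<in> states_with_ellipsoid \<EE>" for \<rho>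
    proof (rule supportedI[of _ _ _ 0])
      fix y assume "y \<in> {z_H \<rho>0..z_G \<rho>0}"
      then have "y = z_B \<rho>"
        using True st[OF that] x_state_z_B(1,2)[of \<rho>] by (simp add: z_H_def z_G_def)
      then show "height_entropy \<rho>0 (z_B \<rho>) + 0 * (y - z_B \<rho>) \<le> height_entropy \<rho>0 y" by simp
    qed
    then show ?thesis using hor by (simp add: type_horizontal_def)
  next
    case False
    then have e: "0 < ell3 \<rho>0" using ell3_nonneg[OF x0] by simp
    have zB: "z_B \<rho> \<in> {z_H \<rho>0<..<z_G \<rho>0}" if "\<rho> \<in> states_with_ellipsoid \<EE>" for \<rho>
      using x_state_z_B(3,4)[of \<rho>] st[OF that] e by simp
    consider (H) "\<forall>z\<in>{z_H \<rho>0<..<z_G \<rho>0}. supported {z_H \<rho>0..z_G \<rho>0} (height_entropy \<rho>0) z"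
      | (V) "chord_optimal (z_H \<rho>0) (z_G \<rho>0) (height_entropy \<rho>0)"
      | (T) "0 < ell1 \<rho>0" "tangent_optimal (z_H \<rho>0) (z_G \<rho>0) (height_entropy \<rho>0)"
      using height_entropy_trichotomy[OF x0 e] by blast
    then show ?thesis
    proof cases
      case H
      then show ?thesis using hor zB by (simp add: type_horizontal_def)
    next
      case V
      then have "vertical_optimal \<rho>" if "\<rho> \<in> states_with_ellipsoid \<EE>" for \<rho>
        using vertical_optimal_of_chord[of \<rho>] st[OF that] pts[OF that] e by simp
      then show ?thesis by (simp add: type_vertical_def)
    next
      case T
      obtain t w c d where t': "t \<in> {z_H \<rho>0<..<z_G \<rho>0}" and w: "w \<in> {z_H \<rho>0, z_G \<rho>0}"
        and touch: "height_entropy \<rho>0 t = c + d * t" "height_entropy \<rho>0 w = c + d * w"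
        and above: "\<And>z. z \<in> {z_H \<rho>0..z_G \<rho>0} - {t, w} \<Longrightarrow> c + d * z < height_entropy \<rho>0 z"
        and supp: "\<And>z. z \<in> {z_H \<rho>0<..<z_G \<rho>0} - open_segment t w \<Longrightarrow>
          supported {z_H \<rho>0..z_G \<rho>0} (height_entropy \<rho>0) z"
        using T(2) unfolding tangent_optimal_def by blast
      have t: "z_H \<rho>0 < t" "t < z_G \<rho>0" using t' by auto
      have tri: "\<not> horizontal_optimal \<rho>" "\<exists>D. optimal_three_state \<rho> D"
        "\<And>D. optimal_three_state \<rho> D \<Longrightarrow>
          snd ` set D = {vector [0, 0, w], right_point \<rho>0 t, left_point \<rho>0 t}"
        if "\<rho> \<in> states_with_ellipsoid \<EE>" "z_B \<rho> \<in> open_segment t w" for \<rho>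
        using three_state_of_tangent[of \<rho> t w c d] st[OF that(1)] pts[OF that(1)] that(2)
          e T(1) t w touch above by simp_all
      have hor': "horizontal_optimal \<rho>"
        if "\<rho> \<in> states_with_ellipsoid \<EE>" "z_B \<rho> \<notin> open_segment t w" for \<rho>
        using hor[OF that(1) supp] zB[OF that(1)] that(2) by simp
      \<comment> \<open>Both kinds of states must exist. The barycentre \<open>t\<close> lies
        outside the open segment and gives a horizontal optimum; the midpoint of the segment gives a
        state of the other kind.\<close>
      obtain \<rho>1 where \<rho>1: "\<rho>1 \<in> states_with_ellipsoid \<EE>" "z_B \<rho>1 = t"
        using state_with_barycentre[OF x0 t] assms(2) by blast
      have mid: "midpoint t w \<in> open_segment t w" using t w by auto
      then have "z_H \<rho>0 < midpoint t w" "midpoint t w < z_G \<rho>0"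
        using t w by (auto simp: open_segment_eq_real_ivl split: if_splits)
      then obtain \<rho>2 where \<rho>2: "\<rho>2 \<in> states_with_ellipsoid \<EE>" "z_B \<rho>2 = midpoint t w"
        using state_with_barycentre[OF x0] assms(2) by blast
      have in_E: "{vector [0, 0, w], right_point \<rho>0 t, left_point \<rho>0 t} \<subseteq> ellipse \<rho>"
        if "\<rho> \<in> states_with_ellipsoid \<EE>" for \<rho>
        using points_in_ellipse[of \<rho> t] vertices_in_ellipse[of \<rho>] st[OF that] pts[OF that] t w e
        by (auto simp: vertex_G_def vertex_H_def)
      have "type_triangle \<EE>"
        unfolding type_triangle_def
      proof (intro conjI)
        show "\<exists>\<rho>\<in>states_with_ellipsoid \<EE>. horizontal_optimal \<rho>"
          using hor'[OF \<rho>1(1)] \<rho>1 by (auto simp: open_segment_def)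
        show "\<exists>\<rho>\<in>states_with_ellipsoid \<EE>. \<not> horizontal_optimal \<rho>"
          using tri(1)[OF \<rho>2(1)] \<rho>2 mid by auto
        show "\<exists>B\<^sub>1 B\<^sub>2 B\<^sub>3. \<forall>\<rho> \<in> states_with_ellipsoid \<EE>. {B\<^sub>1, B\<^sub>2, B\<^sub>3} \<subseteq> ellipse \<rho> \<and>
          (\<not> horizontal_optimal \<rho> \<longrightarrow> (\<exists>D. optimal_three_state \<rho> D) \<and>
             (\<forall>D. optimal_three_state \<rho> D \<longrightarrow> snd ` set D = {B\<^sub>1, B\<^sub>2, B\<^sub>3}))"
        proof (rule exI[of _ "vector [0, 0, w]"], rule exI[of _ "right_point \<rho>0 t"],
            rule exI[of _ "left_point \<rho>0 t"], intro ballI conjI impI allI)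
          fix \<rho> assume \<rho>: "\<rho> \<in> states_with_ellipsoid \<EE>"
          then show "{vector [0, 0, w], right_point \<rho>0 t, left_point \<rho>0 t} \<subseteq> ellipse \<rho>"
            by (rule in_E)
          assume "\<not> horizontal_optimal \<rho>"
          then have between: "z_B \<rho> \<in> open_segment t w" using hor'[OF \<rho>] by blast
          show "\<exists>D. optimal_three_state \<rho> D" by (rule tri(2)[OF \<rho> between])
          show "snd ` set D = {vector [0, 0, w], right_point \<rho>0 t, left_point \<rho>0 t}"
            if "optimal_three_state \<rho> D" for D
            by (rule tri(3)[OF \<rho> between that])
        qed
      qed
      then show ?thesis by simp
    qed
  qed
qed

end
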